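(* For every compact set $K\subset\mathbb{C}\setminus\overline{\mathbb{D}}$ with connected complement, the set $FU(\mathbb{D},K)$ is non-empty; that is, there exists $f\in H(\mathbb{D})$ such that for every non-empty open set $U$ of $A(K)$, $$\underline{d}\left(\left\{n\in\mathbb{N}:\ S_n^{(K)}(f)\in U\right\}\right)>0.$$
   Context: $\mathbb{D}=\{z\in\mathbb{C}:|z|<1\}$ and $\mathbb{N}$ is the set of non-negative integers. $H(\mathbb{D})$ is the Fréchet space of holomorphic functions on $\mathbb{D}$ with the topology of locally uniform convergence. For a compact set $K\subset\mathbb{C}$, $A(K)$ is the Banach space of complex functions continuous on $K$ and holomorphic in the interior of $K$, with the supremum norm. "Connected complement" means $\mathbb{C}\setminus K$ is connected. For $f=\sum_{k\ge 0}a_kz^k\in H(\mathbb{D})$, $S_n^{(K)}(f)\in A(K)$ is the restriction to $K$ of $\sum_{k=0}^n a_kz^k$. The natural lower density of $E\subset\mathbb{N}$ is $\underline{d}(E)=\liminf_{n\to\infty}\frac{|E\cap\{0,\ldots,n\}|}{n}$. $FU(\mathbb{D},K)$ denotes the set of $K$-frequently universal Taylor series, i.e. of all $f\in H(\mathbb{D})$ such that $\underline{d}(\{n\in\mathbb{N}:S_n^{(K)}(f)\in U\})>0$ for every non-empty open $U\subset A(K)$. *)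

theory Defs
  imports "HOL-Analysis.Analysis"
begin

(* Elements of A(K) are extensional functions, i.e. equal to undefined outside K, so that two of
   them are equal iff they agree on K. The metric is the supremum metric of cfunspace. *)
definition A_space :: "complex set \<Rightarrow> (complex \<Rightarrow> complex) metric" where
  "A_space K =
     submetric (cfunspace (top_of_set K) euclidean_metric) {g. g holomorphic_on interior K}"

lemma mspace_A_space:
  assumes "compact K"
  shows "mspace (A_space K) =
    {g \<in> extensional K. continuous_on K g \<and> g holomorphic_on interior K}"
proof -
  have "bounded (g ` K)" if "continuous_on K g" for g :: "complex \<Rightarrow> complex"
    using assms that by (simp add: compact_continuous_image compact_imp_bounded)
  then show ?thesis
    by (auto simp: A_space_def)
qed

lemma mdist_A_space:
  assumes "compact K" "K \<noteq> {}"
    and "g \<in> mspace (A_space K)" "h \<in> mspace (A_space K)"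
  shows "mdist (A_space K) g h = (SUP z\<in>K. dist (g z) (h z))"
proof -
  have "g \<in> mspace (cfunspace (top_of_set K) euclidean_metric)"
       "h \<in> mspace (cfunspace (top_of_set K) euclidean_metric)"
    using assms(3,4) by (simp_all add: A_space_def)
  then have "g \<in> Met_TC.fspace K" "h \<in> Met_TC.fspace K"
    by (auto simp: Met_TC.fspace_def)
  with assms(2) show ?thesis
    by (simp add: A_space_def mdist_cfunspace_eq_mdist_funspace Met_TC.fdist_def)
qed

definition taylor_coeff :: "(complex \<Rightarrow> complex) \<Rightarrow> nat \<Rightarrow> complex" where
  "taylor_coeff f k = (deriv ^^ k) f 0 / fact k"

definition taylor_sum :: "complex set \<Rightarrow> (complex \<Rightarrow> complex) \<Rightarrow> nat \<Rightarrow> complex \<Rightarrow> complex" where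
  "taylor_sum K f n = restrict (\<lambda>z. \<Sum>k\<le>n. taylor_coeff f k * z ^ k) K"

lemma taylor_sum_in_A_space:
  assumes "compact K"
  shows "taylor_sum K f n \<in> mspace (A_space K)"
proof -
  have "continuous_on K (taylor_sum K f n) \<longleftrightarrow>
        continuous_on K (\<lambda>z. \<Sum>k\<le>n. taylor_coeff f k * z ^ k)"
    by (rule continuous_on_cong) (auto simp: taylor_sum_def)
  moreover have "taylor_sum K f n holomorphic_on interior K \<longleftrightarrow>
        (\<lambda>z. \<Sum>k\<le>n. taylor_coeff f k * z ^ k) holomorphic_on interior K"
    by (rule holomorphic_cong) (use interior_subset in \<open>auto simp: taylor_sum_def\<close>)
  ultimately show ?thesis
    using assms by (auto simp: mspace_A_space taylor_sum_def
        intro!: continuous_intros holomorphic_intros)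
qed

(* The value of the quotient at n = 0 is irrelevant for the liminf. *)
definition lower_density :: "nat set \<Rightarrow> ereal" where
  "lower_density E = liminf (\<lambda>n. ereal (real (card (E \<inter> {0..n})) / real n))"

(* H(D) is represented by total functions holomorphic on the unit disc; their values outside the
   disc play no role, since Taylor coefficients at 0 only depend on the germ at 0. *)
definition FU :: "complex set \<Rightarrow> (complex \<Rightarrow> complex) set" where
  "FU K = {f. f holomorphic_on ball 0 1 \<and>
     (\<forall>U. openin (mtopology_of (A_space K)) U \<and> U \<noteq> {} \<longrightarrow>
        lower_density {n. taylor_sum K f n \<in> U} > 0)}"

end

theory Submission
  imports Defs "HOL-Complex_Analysis.Complex_Analysis"
begin

text \<open>
  Polynomials are dense in \<open>A(K)\<close> by Mergelyan's theorem. To prove it, extend \<open>f\<close> to a compactly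
  supported continuous function and cut the plane into squares of side \<open>d\<close>. The part of \<open>f\<close>
  belonging to a square \<open>Q\<close>, namely \<open>f\<close> on \<open>Q\<close> minus the Cauchy integral of \<open>f\<close> over the
  boundary of \<open>Q\<close>, vanishes if \<open>f\<close> is holomorphic on \<open>Q\<close>, and the parts add up to \<open>f\<close>. Near each
  remaining square there is a connected set of diameter about \<open>d\<close> outside \<open>K\<close>, containing points
  \<open>p\<close>, \<open>q\<close> at distance \<open>d\<close>; a branch of the square root of \<open>(z - p) (z - q)\<close> off this set yields a
  function \<open>g\<close>, bounded by a multiple of \<open>1 / d\<close>, which agrees with \<open>1 / (z - m)\<close>, \<open>m\<close> the midpoint,
  up to third order at infinity. Replacing the part of \<open>Q\<close> by the combination of \<open>g\<close> and \<open>g\<^sup>2\<close> with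
  the same first two Laurent coefficients leaves an error which decays like an inverse cube and
  hence sums to a multiple of the modulus of continuity of \<open>f\<close> at scale \<open>d\<close>. Finally \<open>g\<close> is
  approximable by polynomials, since the branch is a product of square roots along a chain of
  points outside \<open>K\<close>.

  For frequent universality, take a polynomial \<open>w\<close> with \<open>w 0 = 0\<close> which is close to 0 on the closed
  disc and close to 1 on \<open>K\<close>. The upper half of the binomial expansion of
  \<open>(w + (1 - w)) ^ (2 * M)\<close> is divisible by \<open>z ^ M\<close>, has degree at most a fixed multiple of \<open>M\<close>, is
  exponentially small on the disc and exponentially close to 1 on \<open>K\<close>. Multiplied by
  \<open>q - S\<close>, where \<open>S\<close> is the current partial sum and \<open>q\<close> the next target, it is a block which moves
  the partial sum to \<open>q\<close> on \<open>K\<close>. As the blocks occupy only part of geometrically growing ranges of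
  degrees, each target reached is kept for a positive proportion of indices, and every target
  is visited with bounded gaps.
\<close>

section \<open>Uniform approximation by polynomials\<close>

definition poly_approximable :: "complex set \<Rightarrow> (complex \<Rightarrow> complex) \<Rightarrow> bool" where
  "poly_approximable K g \<longleftrightarrow> (\<forall>e>0. \<exists>p. \<forall>z\<in>K. norm (g z - poly p z) < e)"

lemma poly_approximable_poly [simp, intro]: "poly_approximable K (poly p)"
  unfolding poly_approximable_def by (metis diff_self norm_zero)

lemma poly_approximable_const [simp, intro]: "poly_approximable K (\<lambda>z. c)"
proof -
  have "poly [:c:] = (\<lambda>z. c)" by auto
  then show ?thesis by (metis poly_approximable_poly)
qed

lemma poly_approximable_ident [simp, intro]: "poly_approximable K (\<lambda>z. z)"
proof -
  have "poly [:0, 1:] = (\<lambda>z. z :: complex)" by auto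
  then show ?thesis by (metis poly_approximable_poly)
qed

lemma poly_approximable_cong:
  assumes "\<And>z. z \<in> K \<Longrightarrow> f z = g z"
  shows "poly_approximable K f \<longleftrightarrow> poly_approximable K g"
  using assms by (simp add: poly_approximable_def)

lemma poly_approximable_limit:
  assumes "\<And>e. e > 0 \<Longrightarrow> \<exists>h. poly_approximable K h \<and> (\<forall>z\<in>K. norm (g z - h z) < e)"
  shows "poly_approximable K g"
  unfolding poly_approximable_def
proof (intro allI impI)
  fix e :: real assume "e > 0"
  then obtain h where h: "poly_approximable K h" "\<forall>z\<in>K. norm (g z - h z) < e / 2"
    using assms[of "e / 2"] by auto
  then obtain p where p: "\<forall>z\<in>K. norm (h z - poly p z) < e / 2"
    using \<open>e > 0\<close> unfolding poly_approximable_def by (meson half_gt_zero)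
  have "norm (g z - poly p z) < e" if "z \<in> K" for z
  proof -
    have "g z - poly p z = (g z - h z) + (h z - poly p z)" by simp
    then have "norm (g z - poly p z) \<le> norm (g z - h z) + norm (h z - poly p z)"
      by (metis norm_triangle_ineq)
    then show ?thesis using h p that by fastforce
  qed
  then show "\<exists>p. \<forall>z\<in>K. norm (g z - poly p z) < e" by blast
qed

lemma poly_approximable_add:
  assumes "poly_approximable K f" "poly_approximable K g"
  shows "poly_approximable K (\<lambda>z. f z + g z)"
  unfolding poly_approximable_def
proof (intro allI impI)
  fix e :: real assume "e > 0"
  then have "e / 2 > 0" by simp
  then obtain p q where pq: "\<forall>z\<in>K. norm (f z - poly p z) < e / 2" "\<forall>z\<in>K. norm (g z - poly q z) < e / 2"
    using assms unfolding poly_approximable_def by meson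
  have "norm (f z + g z - poly (p + q) z) < e" if "z \<in> K" for z
  proof -
    have "f z + g z - poly (p + q) z = (f z - poly p z) + (g z - poly q z)" by simp
    then have "norm (f z + g z - poly (p + q) z) \<le> norm (f z - poly p z) + norm (g z - poly q z)"
      by (metis norm_triangle_ineq)
    then show ?thesis using pq that by fastforce
  qed
  then show "\<exists>p. \<forall>z\<in>K. norm (f z + g z - poly p z) < e" by blast
qed

lemma poly_approximable_bounded:
  assumes "compact K" "poly_approximable K f"
  obtains B where "B > 0" "\<And>z. z \<in> K \<Longrightarrow> norm (f z) \<le> B"
proof -
  obtain p where p: "\<forall>z\<in>K. norm (f z - poly p z) < 1"
    using assms(2) unfolding poly_approximable_def by (meson zero_less_one)
  have "compact (poly p ` K)"
    by (intro compact_continuous_image assms continuous_intros)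
  then obtain B where B: "B > 0" "\<And>z. z \<in> K \<Longrightarrow> norm (poly p z) \<le> B"
    using compact_imp_bounded bounded_pos by (metis imageI)
  have "norm (f z) \<le> B + 1" if "z \<in> K" for z
    using p B(2) that norm_triangle_ineq2[of "f z" "poly p z"] by fastforce
  then show ?thesis using that[of "B + 1"] B(1) by simp
qed

lemma poly_approximable_mult:
  assumes K: "compact K" and f: "poly_approximable K f" and g: "poly_approximable K g"
  shows "poly_approximable K (\<lambda>z. f z * g z)"
proof (rule poly_approximable_limit)
  fix e :: real assume "e > 0"
  obtain B where B: "B > 0" "\<And>z. z \<in> K \<Longrightarrow> norm (g z) \<le> B"
    using poly_approximable_bounded[OF K g] by blast
  obtain p where p: "\<forall>z\<in>K. norm (f z - poly p z) < e / (2 * B)"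
    using f B \<open>e > 0\<close> unfolding poly_approximable_def by (metis divide_pos_pos mult_pos_pos zero_less_numeral)
  obtain C where C: "C > 0" "\<And>z. z \<in> K \<Longrightarrow> norm (poly p z) \<le> C"
    using poly_approximable_bounded[OF K, of "poly p"] by blast
  obtain q where q: "\<forall>z\<in>K. norm (g z - poly q z) < e / (2 * C)"
    using g C \<open>e > 0\<close> unfolding poly_approximable_def by (metis divide_pos_pos mult_pos_pos zero_less_numeral)
  have "norm (f z * g z - poly (p * q) z) < e" if "z \<in> K" for z
  proof -
    have "f z * g z - poly (p * q) z = (f z - poly p z) * g z + poly p z * (g z - poly q z)"
      by (simp add: algebra_simps)
    then have "norm (f z * g z - poly (p * q) z) \<le> norm (f z - poly p z) * norm (g z) + norm (poly p z) * norm (g z - poly q z)"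
      by (metis norm_triangle_ineq norm_mult)
    also have "\<dots> \<le> norm (f z - poly p z) * B + C * norm (g z - poly q z)"
      using B C that by (intro add_mono mult_mono) auto
    also have "\<dots> < e / (2 * B) * B + C * (e / (2 * C))"
      using p q B C that by (intro add_strict_mono mult_strict_right_mono mult_strict_left_mono) auto
    also have "\<dots> = e" using B C by simp
    finally show ?thesis .
  qed
  then show "\<exists>h. poly_approximable K h \<and> (\<forall>z\<in>K. norm (f z * g z - h z) < e)"
    by (intro exI[of _ "poly (p * q)"]) auto
qed

lemma poly_approximable_cmult:
  assumes "compact K" "poly_approximable K f"
  shows "poly_approximable K (\<lambda>z. c * f z)"
  using poly_approximable_mult[OF assms(1) _ assms(2)] by simp

lemma poly_approximable_sum:
  assumes "\<And>i. i \<in> I \<Longrightarrow> poly_approximable K (f i)"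
  shows "poly_approximable K (\<lambda>z. \<Sum>i\<in>I. f i z)"
  using assms by (induction I rule: infinite_finite_induct) (auto intro: poly_approximable_add)

lemma poly_approximable_power:
  assumes "compact K" "poly_approximable K f"
  shows "poly_approximable K (\<lambda>z. f z ^ n)"
  by (induction n) (auto intro: poly_approximable_mult assms)

text \<open>As \<open>w\<close> maps \<open>K\<close> into a disc of radius less than 1, the Taylor
  polynomials of \<open>h\<close> converge uniformly on the values of \<open>w\<close>, and each of
  them is a polynomial in \<open>w\<close>.\<close>

lemma poly_approximable_holomorphic_compose:
  assumes K: "compact K" and h: "h holomorphic_on ball 0 1"
    and w: "poly_approximable K w" and bd: "\<And>z. z \<in> K \<Longrightarrow> norm (w z) \<le> \<rho>" and "\<rho> < 1"
  shows "poly_approximable K (\<lambda>z. h (w z))"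
proof (rule poly_approximable_limit)
  fix e :: real assume "e > 0"
  define c where "c n = (deriv ^^ n) h 0 / fact n" for n
  \<comment> \<open>For empty \<open>K\<close> the bound \<rho> may be negative; the maximum keeps
    the radius non-negative.\<close>
  define r where "r = max 0 \<rho>"
  have r: "0 \<le> r" "r < 1" "\<And>z. z \<in> K \<Longrightarrow> norm (w z) \<le> r"
    using bd \<open>\<rho> < 1\<close> by (fastforce simp: r_def)+
  have sums: "(\<lambda>n. c n * x ^ n) sums h x" if "norm x < 1" for x
    using holomorphic_power_series[OF h, of x] that by (simp add: c_def)
  have "summable (\<lambda>n. norm (c n * of_real r ^ n))"
  \<comment> \<open>Convergence at the midpoint of \<open>r\<close> and 1 gives absolute convergence
    at \<open>r\<close>, as the M-test requires.\<close>
  proof (rule powser_insidea)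
    show "summable (\<lambda>n. c n * of_real ((1 + r) / 2) ^ n)"
      using sums[of "of_real ((1 + r) / 2)"] r by (intro sums_summable) (auto simp del: of_real_add of_real_divide)
    show "norm (of_real r :: complex) < norm (of_real ((1 + r) / 2) :: complex)"
      using r by (simp del: of_real_add of_real_divide)
  qed
  then have summ: "summable (\<lambda>n. norm (c n) * r ^ n)"
    using r by (simp add: norm_mult norm_power)
  have "uniform_limit (cball 0 r) (\<lambda>n x. \<Sum>i<n. c i * x ^ i) (\<lambda>x. \<Sum>i. c i * x ^ i) sequentially"
    using summ by (intro Weierstrass_m_test[where M = "\<lambda>n. norm (c n) * r ^ n"])
      (auto simp: norm_mult norm_power intro!: mult_left_mono power_mono)
  from uniform_limitD[OF this \<open>e > 0\<close>] obtain n where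
    n: "\<forall>x\<in>cball 0 r. dist (\<Sum>i<n. c i * x ^ i) (\<Sum>i. c i * x ^ i) < e"
    by (auto simp: eventually_sequentially)
  have "norm (h (w z) - (\<Sum>i<n. c i * w z ^ i)) < e" if "z \<in> K" for z
  proof -
    have "norm (w z) \<le> r" using r that by blast
    then have "(\<Sum>i. c i * w z ^ i) = h (w z)"
      using sums[of "w z"] r by (simp add: sums_iff)
    then show ?thesis
      using n[rule_format, of "w z"] \<open>norm (w z) \<le> r\<close> by (simp add: dist_norm norm_minus_commute)
  qed
  then show "\<exists>g. poly_approximable K g \<and> (\<forall>z\<in>K. norm (h (w z) - g z) < e)"
    by (intro exI[of _ "\<lambda>z. \<Sum>i<n. c i * w z ^ i"])
      (auto intro!: poly_approximable_sum poly_approximable_cmult poly_approximable_power K w)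
qed

section \<open>Pushing poles: Runge's theorem for Cauchy kernels\<close>

text \<open>The kernel with pole \<open>a\<close> is the kernel with pole \<open>b\<close> times
  \<open>1 / (1 - (a - b) / (z - b))\<close>, a geometric series with ratio at most \<rho> in
  modulus on \<open>K\<close>.\<close>

lemma poly_approximable_inverse_diff_near:
  assumes K: "compact K" and b: "poly_approximable K (\<lambda>z. 1 / (z - b))"
    and \<rho>: "\<rho> < 1" and near: "\<And>z. z \<in> K \<Longrightarrow> norm (a - b) \<le> \<rho> * norm (z - b)"
    and "b \<notin> K"
  shows "poly_approximable K (\<lambda>z. 1 / (z - a))"
proof -
  have "poly_approximable K (\<lambda>z. 1 / (1 - (a - b) * (1 / (z - b))))"
  proof (rule poly_approximable_holomorphic_compose[where h = "\<lambda>x. 1 / (1 - x)" and w = "\<lambda>z. (a - b) * (1 / (z - b))", OF K _ _ _ \<rho>])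
    show "(\<lambda>x::complex. 1 / (1 - x)) holomorphic_on ball 0 1"
      by (intro holomorphic_intros) auto
    show "poly_approximable K (\<lambda>z. (a - b) * (1 / (z - b)))"
      by (intro poly_approximable_cmult K b)
    show "norm ((a - b) * (1 / (z - b))) \<le> \<rho>" if "z \<in> K" for z
      using near[OF that] that \<open>b \<notin> K\<close>
      by (auto simp: norm_mult norm_divide divide_simps)
  qed
  then have "poly_approximable K (\<lambda>z. 1 / (z - b) * (1 / (1 - (a - b) * (1 / (z - b)))))"
    by (intro poly_approximable_mult K b)
  moreover have "1 / (z - b) * (1 / (1 - (a - b) * (1 / (z - b)))) = 1 / (z - a)" if "z \<in> K" for z
  proof -
    have "z \<noteq> b" using that \<open>b \<notin> K\<close> by auto
    then show ?thesis by (simp add: field_simps)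
  qed
  ultimately show ?thesis
    using poly_approximable_cong by (metis (no_types, lifting))
qed

text \<open>Approximability does not change under small moves of the pole, so it is constant on the
  connected complement. For a pole far from \<open>K\<close> the geometric series in
  \<open>z / b\<close> converges uniformly on \<open>K\<close>.\<close>

lemma poly_approximable_inverse_diff:
  assumes K: "compact K" "connected (- K)" and a: "a \<notin> K"
  shows "poly_approximable K (\<lambda>z. 1 / (z - a))"
proof -
  obtain B where B: "B > 0" "\<And>z. z \<in> K \<Longrightarrow> norm z \<le> B"
    using compact_imp_bounded[OF K(1)] bounded_pos by metis
  define b :: complex where "b = of_real (2 * B)"
  have nb: "norm b = 2 * B" using B by (simp add: b_def)
  have "b \<notin> K" using B nb by fastforce
  have "poly_approximable K (\<lambda>z. 1 / (1 - (1 / b) * z))"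
  proof (rule poly_approximable_holomorphic_compose[where h = "\<lambda>x. 1 / (1 - x)" and w = "\<lambda>z. (1 / b) * z", OF K(1)])
    show "(\<lambda>x::complex. 1 / (1 - x)) holomorphic_on ball 0 1"
      by (intro holomorphic_intros) auto
    show "poly_approximable K (\<lambda>z. (1 / b) * z)"
      by (intro poly_approximable_cmult K poly_approximable_ident)
    show "norm ((1 / b) * z) \<le> 1 / 2" if "z \<in> K" for z
      using B(2)[OF that] B(1) nb by (simp add: norm_divide divide_simps)
  qed auto
  then have "poly_approximable K (\<lambda>z. (- 1 / b) * (1 / (1 - (1 / b) * z)))"
    by (intro poly_approximable_cmult K)
  moreover have "(- 1 / b) * (1 / (1 - (1 / b) * z)) = 1 / (z - b)" if "z \<in> K" for z
  proof -
    have "b \<noteq> 0" "z \<noteq> b" using nb B \<open>b \<notin> K\<close> that by auto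
    then show ?thesis by (simp add: divide_simps)
  qed
  ultimately have base: "poly_approximable K (\<lambda>z. 1 / (z - b))"
    using poly_approximable_cong by (metis (no_types, lifting))
  define R where "R = (\<lambda>a b. poly_approximable K (\<lambda>z. 1 / (z - a)) \<longleftrightarrow> poly_approximable K (\<lambda>z. 1 / (z - b)))"
  have "R a b"
  proof (rule connected_equivalence_relation[OF K(2)])
    show "a \<in> - K" "b \<in> - K" using a \<open>b \<notin> K\<close> by auto
    fix x assume x: "x \<in> - K"
    obtain d where d: "d > 0" "ball x d \<subseteq> - K"
      using x K(1) by (metis compact_imp_closed open_Compl open_contains_ball)
    \<comment> \<open>With radius \<open>d / 3\<close> the ratio stays at most 1/2 in both
      directions: from \<open>x\<close> the distance to \<open>K\<close> is at least
      \<open>d\<close>, from \<open>y\<close> at least \<open>2 / 3 * d\<close>.\<close>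
    have "R x y" if y: "y \<in> ball x (d / 3)" for y
    proof -
      have "y \<notin> K" "x \<notin> K" using y d x by (auto simp: subset_iff)
      have xy: "norm (x - y) \<le> d / 3" using y by (simp add: dist_norm)
      have far: "norm (z - x) \<ge> d" if "z \<in> K" for z
      proof -
        have "z \<notin> ball x d" using d that by blast
        then show ?thesis by (simp add: dist_norm norm_minus_commute)
      qed
      have far': "norm (z - y) \<ge> 2 / 3 * d" if "z \<in> K" for z
        using far[OF that] xy norm_triangle_ineq[of "z - y" "y - x"] by (simp add: norm_minus_commute)
      show ?thesis unfolding R_def
      proof
        assume *: "poly_approximable K (\<lambda>z. 1 / (z - x))"
        show "poly_approximable K (\<lambda>z. 1 / (z - y))"
          by (rule poly_approximable_inverse_diff_near[OF K(1) *, of "1/2"])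
            (use xy far \<open>x \<notin> K\<close> d in \<open>fastforce simp: norm_minus_commute\<close>)+
      next
        assume *: "poly_approximable K (\<lambda>z. 1 / (z - y))"
        show "poly_approximable K (\<lambda>z. 1 / (z - x))"
          by (rule poly_approximable_inverse_diff_near[OF K(1) *, of "1/2"])
            (use xy far' \<open>y \<notin> K\<close> d in \<open>fastforce simp: norm_minus_commute\<close>)+
      qed
    qed
    moreover have "ball x (d / 3) \<subseteq> - K"
      using d subset_ball[of "d / 3" d x] by auto
    moreover have "x \<in> ball x (d / 3)" using d by simp
    ultimately show "\<exists>T. openin (top_of_set (- K)) T \<and> x \<in> T \<and> (\<forall>y\<in>T. R x y)"
      using open_openin_trans open_ball K(1)
      by (intro exI[of _ "ball x (d/3)"]) (auto simp: openin_open_eq compact_imp_closed open_Compl)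
  qed (auto simp: R_def)
  then show ?thesis using base by (simp add: R_def)
qed

section \<open>Square roots along paths avoiding a compact set\<close>

text \<open>\<open>t\<close> is a continuous branch of the square root of
  \<open>(z - y) / (z - x)\<close> near \<open>L\<close>. In the application \<open>L\<close> is
  \<open>K\<close> together with the exterior of a disc: approximation is wanted on \<open>K\<close>
  only, but the branch must also be followed to infinity.\<close>

definition sqrt_quotient :: "complex set \<Rightarrow> complex set \<Rightarrow> complex \<Rightarrow> complex \<Rightarrow> bool" where
  "sqrt_quotient K L x y \<longleftrightarrow> (\<exists>t V. open V \<and> L \<subseteq> V \<and> continuous_on V t \<and> poly_approximable K t \<and>
     (\<forall>z\<in>V. t z ^ 2 * (z - x) = z - y))"

lemma sqrt_quotient_trans:
  assumes "compact K" "sqrt_quotient K L x y" "sqrt_quotient K L y w"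
  shows "sqrt_quotient K L x w"
proof -
  obtain t V where t: "open V" "L \<subseteq> V" "continuous_on V t" "poly_approximable K t"
    "\<forall>z\<in>V. t z ^ 2 * (z - x) = z - y"
    using assms(2) unfolding sqrt_quotient_def by blast
  obtain u W where u: "open W" "L \<subseteq> W" "continuous_on W u" "poly_approximable K u"
    "\<forall>z\<in>W. u z ^ 2 * (z - y) = z - w"
    using assms(3) unfolding sqrt_quotient_def by blast
  have "(t z * u z) ^ 2 * (z - x) = z - w" if "z \<in> V \<inter> W" for z
  proof -
    have "(t z * u z) ^ 2 * (z - x) = u z ^ 2 * (t z ^ 2 * (z - x))"
      by (simp add: power_mult_distrib)
    also have "\<dots> = z - w" using t(5) u(5) that by (metis IntD1 IntD2)
    finally show ?thesis .
  qed
  moreover have "continuous_on (V \<inter> W) (\<lambda>z. t z * u z)"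
    by (intro continuous_intros continuous_on_subset[OF t(3)] continuous_on_subset[OF u(3)]) auto
  ultimately show ?thesis
    unfolding sqrt_quotient_def using t u assms(1)
    by (intro exI[of _ "\<lambda>z. t z * u z"] exI[of _ "V \<inter> W"]) (auto intro: poly_approximable_mult)
qed

text \<open>The quotient is \<open>1 - (y - x) / (z - x)\<close>, which stays within distance less
  than 1 of 1, so the principal square root serves as the branch.\<close>

lemma sqrt_quotient_near:
  assumes K: "compact K" "connected (- K)" and "K \<subseteq> L" and "e > 0"
    and far: "\<And>z. z \<in> L \<Longrightarrow> norm (z - x) \<ge> e" and near: "norm (y - x) \<le> e / 2"
  shows "sqrt_quotient K L x y"
proof -
  \<comment> \<open>Any factor strictly between 1/2 and 1 would do: \<open>V\<close> is then an open
    neighbourhood of \<open>L\<close> on which \<open>(y - x) / (z - x)\<close> is still smaller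
    than 1.\<close>
  define V where "V = {z. norm (z - x) > 3 / 4 * e}"
  have nz: "z - x \<noteq> 0" if "z \<in> V" for z using that \<open>e > 0\<close> by (auto simp: V_def)
  have KV: "L \<subseteq> V" using far \<open>e > 0\<close> by (force simp: V_def)
  have small: "norm ((y - x) / (z - x)) < 1" if "z \<in> V" for z
    using that near nz[OF that] \<open>e > 0\<close> by (auto simp: V_def norm_divide divide_simps)
  have h: "(\<lambda>w. csqrt (1 - w)) holomorphic_on ball 0 1"
  proof (intro holomorphic_intros)
    fix w :: complex assume "w \<in> ball 0 1"
    then have "Re w < 1" using complex_Re_le_cmod[of w] by auto
    then have "Re (1 - w) > 0" by simp
    then show "1 - w \<notin> \<real>\<^sub>\<le>\<^sub>0" using complex_nonpos_Reals_iff by fastforce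
  qed
  have "open V" unfolding V_def by (intro open_Collect_less continuous_intros)
  moreover have "continuous_on V (\<lambda>z. csqrt (1 - (y - x) / (z - x)))"
    by (rule continuous_on_compose2[OF holomorphic_on_imp_continuous_on[OF h]])
      (use small nz in \<open>auto intro!: continuous_intros\<close>)
  moreover have "poly_approximable K (\<lambda>z. csqrt (1 - (y - x) * (1 / (z - x))))"
  proof (rule poly_approximable_holomorphic_compose[where h = "\<lambda>w. csqrt (1 - w)"
        and w = "\<lambda>z. (y - x) * (1 / (z - x))", OF K(1) h])
    have "x \<notin> K" using far[of x] \<open>e > 0\<close> \<open>K \<subseteq> L\<close> by auto
    then show "poly_approximable K (\<lambda>z. (y - x) * (1 / (z - x)))"
      by (intro poly_approximable_cmult poly_approximable_inverse_diff K)
    show "norm ((y - x) * (1 / (z - x))) \<le> 1 / 2" if "z \<in> K" for z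
    proof -
      have "norm (z - x) \<ge> e" using far that \<open>K \<subseteq> L\<close> by auto
      then have "norm (y - x) \<le> 1 / 2 * norm (z - x)" "norm (z - x) > 0"
        using near \<open>e > 0\<close> by auto
      then show ?thesis by (simp add: norm_divide divide_simps)
    qed
  qed auto
  moreover have "csqrt (1 - (y - x) / (z - x)) ^ 2 * (z - x) = z - y" if "z \<in> V" for z
    using nz[OF that] by (simp add: field_simps)
  ultimately show ?thesis
    unfolding sqrt_quotient_def using KV by (intro exI) auto
qed

text \<open>Each point of \<open>S\<close> has a positive distance from \<open>L\<close>, so nearby
  points are related; connectedness of \<open>S\<close> links \<open>x\<close> to \<open>y\<close>
  by multiplying finitely many such roots.\<close>

lemma sqrt_quotient_path:
  assumes K: "compact K" "connected (- K)" and "K \<subseteq> L" "closed L" "L \<noteq> {}"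
    and S: "connected S" "S \<inter> L = {}" "x \<in> S" "y \<in> S"
  shows "sqrt_quotient K L x y"
proof -
  \<comment> \<open>Both directions are carried along, since symmetry is not evident: inverting
    \<open>t\<close> need not preserve approximability directly.\<close>
  define R where "R = (\<lambda>x y. sqrt_quotient K L x y \<and> sqrt_quotient K L y x)"
  have "R x y"
  proof (rule connected_equivalence_relation[OF S(1,3,4)])
    fix a assume "a \<in> S"
    define e where "e = infdist a L"
    have "e > 0"
      unfolding e_def using \<open>a \<in> S\<close> S(2) assms(4,5) infdist_pos_not_in_closed by blast
    have far: "norm (z - a) \<ge> e" if "z \<in> L" for z
      using infdist_le[OF that, of a] by (simp add: e_def dist_norm norm_minus_commute)
    have "R a b" if "b \<in> ball a (e / 3)" for b
    proof -
      have ab: "norm (a - b) \<le> e / 3" using that by (simp add: dist_norm)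
      have far': "norm (z - b) \<ge> 2 / 3 * e" if "z \<in> L" for z
        using far[OF that] ab norm_triangle_ineq[of "z - b" "b - a"] by (simp add: norm_minus_commute)
      have "sqrt_quotient K L a b"
        using ab \<open>e > 0\<close> by (intro sqrt_quotient_near[OF K \<open>K \<subseteq> L\<close> \<open>e > 0\<close> far]) (auto simp: norm_minus_commute)
      moreover have "sqrt_quotient K L b a"
        using ab \<open>e > 0\<close> by (intro sqrt_quotient_near[OF K \<open>K \<subseteq> L\<close> _ far']) (auto simp: norm_minus_commute)
      ultimately show ?thesis by (simp add: R_def)
    qed
    then show "\<exists>T. openin (top_of_set S) T \<and> a \<in> T \<and> (\<forall>b\<in>T. R a b)"
      using \<open>a \<in> S\<close> \<open>e > 0\<close> by (intro exI[of _ "S \<inter> ball a (e / 3)"]) (auto simp: openin_open_Int)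
  qed (auto simp: R_def intro: sqrt_quotient_trans[OF K(1)])
  then show ?thesis by (simp add: R_def)
qed

section \<open>A bounded substitute for the Cauchy kernel\<close>

text \<open>A path in the complement from \<open>p\<close> to a point outside both \<open>K\<close>
  and the disc is cut off where it first meets the circle of radius \<open>d\<close>.\<close>

lemma escaping_path:
  fixes K :: "complex set"
  assumes K: "compact K" "connected (- K)" and p: "p \<notin> K" and "d > 0"
  obtains S q where "connected S" "p \<in> S" "q \<in> S" "S \<subseteq> - K" "S \<subseteq> cball p d" "norm (q - p) = d"
proof -
  have "bounded (K \<union> cball p d)"
    using compact_imp_bounded[OF K(1)] by auto
  then obtain b where b: "b \<notin> K" "b \<notin> cball p d"
    using not_bounded_UNIV by (metis Un_iff UNIV_eq_I)
  have "path_connected (- K)"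
    using K by (intro connected_open_path_connected) (auto simp: compact_imp_closed open_Compl)
  then obtain g where g: "path g" "path_image g \<subseteq> - K" "pathstart g = p" "pathfinish g = b"
    using p b unfolding path_connected_def by (metis ComplI)
  obtain h where h: "path h" "pathstart h = pathstart g" "path_image h \<subseteq> path_image g \<inter> cball p d"
    "pathfinish h \<in> frontier (cball p d)"
    by (rule exists_path_subpath_to_frontier_closed[OF closed_cball g(1)]) (use g b \<open>d > 0\<close> in auto)
  show ?thesis
  proof (rule that)
    show "connected (path_image h)" using h by (simp add: connected_path_image)
    show "p \<in> path_image h" "pathfinish h \<in> path_image h"
      using h(2) g(3) pathstart_in_path_image[of h] pathfinish_in_path_image[of h] by auto
    show "norm (pathfinish h - p) = d"
      using h(4) by (simp add: dist_norm norm_minus_commute)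
  qed (use h g in auto)
qed

text \<open>Taking \<open>s\<close> to be a square root of \<open>(z - p) (z - q)\<close>, this selects the branch with
  \<open>s z \<sim> z\<close> at infinity.\<close>

lemma branch_sign:
  assumes A: "connected A" and s: "continuous_on A s" and nz: "\<And>z. z \<in> A \<Longrightarrow> z \<noteq> m"
    and pos: "\<And>z. z \<in> A \<Longrightarrow> Re ((s z / (z - m)) ^ 2) > 0"
  obtains c :: complex where "c = 1 \<or> c = - 1" "\<And>z. z \<in> A \<Longrightarrow> Re (c * s z / (z - m)) > 0"
proof -
  define f where "f z = Re (s z / (z - m))" for z
  have "continuous_on A f"
    unfolding f_def using nz by (intro continuous_intros s) auto
  then have conn: "connected (f ` A)" using A connected_continuous_image by blast
  \<comment> \<open>A purely imaginary quotient would have a square with non-positive real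
    part.\<close>
  have "f z \<noteq> 0" if "z \<in> A" for z
  proof
    assume "f z = 0"
    then have "Re ((s z / (z - m)) ^ 2) \<le> 0" by (simp add: f_def Re_power2)
    then show False using pos[OF that] by simp
  qed
  then have n0: "0 \<notin> f ` A" by auto
  have "(\<forall>z\<in>A. f z > 0) \<or> (\<forall>z\<in>A. f z < 0)"
  proof (rule ccontr)
    assume "\<not> ?thesis"
    then obtain a b where ab: "a \<in> A" "b \<in> A" "f a \<le> 0" "f b \<ge> 0" by force
    then show False using connectedD_interval[OF conn, of "f a" "f b" 0] n0 by blast
  qed
  then show ?thesis
  proof
    assume "\<forall>z\<in>A. f z > 0"
    then show ?thesis using that[of 1] by (simp add: f_def)
  next
    assume "\<forall>z\<in>A. f z < 0"
    then show ?thesis using that[of "-1"] by (simp add: f_def)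
  qed
qed

text \<open>Put \<open>u = z - m\<close> and let \<open>s\<close> be the root of
  \<open>u ^ 2 - \<beta>\<close> that behaves like \<open>u\<close> at infinity. Then
  \<open>g = (- 2 / \<beta>) * (s - u) = 2 / (s + u)\<close>. The first form is of order
  \<open>1 / d\<close> near \<open>m\<close>, as \<beta> has modulus \<open>d ^ 2 / 4\<close>; the
  second gives \<open>g - 1 / u = \<beta> / ((s + u) ^ 2 * u)\<close>, which is of third order at
  infinity.\<close>

lemma exists_approximate_cauchy_kernel:
  assumes K: "compact K" "connected (- K)" and p: "p \<notin> K" and "d > 0"
  obtains g m V where "poly_approximable K g" "open V" "K \<subseteq> V" "continuous_on V g"
    "norm (m - p) \<le> d / 2"
    "\<forall>z\<in>V. norm (g z) \<le> 52 / d"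
    "\<forall>z\<in>V. norm (z - m) \<ge> 3 * d \<longrightarrow> norm (g z) \<le> 2 / norm (z - m)"
    "\<forall>z\<in>V. norm (z - m) \<ge> 3 * d \<longrightarrow> norm (g z - 1 / (z - m)) \<le> d\<^sup>2 / (4 * norm (z - m) ^ 3)"
proof -
  obtain S q where S: "connected S" "p \<in> S" "q \<in> S" "S \<subseteq> - K" "S \<subseteq> cball p d" "norm (q - p) = d"
    using escaping_path[OF K p \<open>d > 0\<close>] .
  \<comment> \<open>Adding the exterior of a disc containing \<open>S\<close> makes the branch
    available up to infinity.\<close>
  define L where "L = K \<union> - ball p (2 * d)"
  have "sqrt_quotient K L p q"
  proof (rule sqrt_quotient_path[OF K _ _ _ S(1) _ S(2,3)])
    show "closed L" unfolding L_def using K(1) by (intro closed_Un closed_Compl open_ball compact_imp_closed)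
    have "p + of_real (2 * d) \<in> L" using \<open>d > 0\<close> by (simp add: L_def dist_norm)
    then show "L \<noteq> {}" by auto
    have "S \<subseteq> ball p (2 * d)" using S(5) \<open>d > 0\<close> by (auto simp: subset_iff)
    then show "S \<inter> L = {}" using S(4) by (auto simp: L_def)
  qed (simp add: L_def)
  then obtain t V where t: "open V" "L \<subseteq> V" "continuous_on V t" "poly_approximable K t"
    "\<And>z. z \<in> V \<Longrightarrow> t z ^ 2 * (z - p) = z - q"
    unfolding sqrt_quotient_def by blast
  define m where "m = (p + q) / 2"
  define \<beta> where "\<beta> = (q - p)\<^sup>2 / 4"
  have n\<beta>: "norm \<beta> = d\<^sup>2 / 4" using S(6) by (simp add: \<beta>_def norm_divide norm_power)
  have "\<beta> \<noteq> 0" using n\<beta> \<open>d > 0\<close> by auto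
  have mp: "norm (m - p) = d / 2" and mq: "norm (m - q) = d / 2"
  proof -
    have "m - p = (q - p) / 2" "m - q = - ((q - p) / 2)" by (auto simp: m_def field_simps)
    then show "norm (m - p) = d / 2" "norm (m - q) = d / 2"
      using S(6) by (simp_all only: norm_minus_cancel norm_divide) simp_all
  qed
  define s0 where "s0 z = (z - p) * t z" for z
  have s0: "s0 z ^ 2 = (z - p) * (z - q)" if "z \<in> V" for z
  proof -
    have "s0 z ^ 2 = (z - p) * (t z ^ 2 * (z - p))" by (simp add: s0_def power2_eq_square)
    then show ?thesis using t(5)[OF that] by simp
  qed
  have pq: "(z - p) * (z - q) = (z - m) ^ 2 - \<beta>" for z
    by (simp add: m_def \<beta>_def field_simps power2_eq_square)
  \<comment> \<open>The sign of the branch is fixed on this connected exterior, which lies in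
    \<open>L\<close> because \<open>3 * d - d / 2 \<ge> 2 * d\<close>.\<close>
  define A where "A = - ball m (3 * d)"
  have AD: "z \<in> A \<longleftrightarrow> norm (z - m) \<ge> 3 * d" for z
    by (simp add: A_def dist_norm norm_minus_commute not_less)
  have "A \<subseteq> L"
  proof
    fix z assume "z \<in> A"
    then have "norm (z - p) \<ge> 2 * d"
      using mp norm_triangle_ineq4[of "z - p" "m - p"] \<open>d > 0\<close> by (simp add: AD)
    then show "z \<in> L" by (simp add: L_def dist_norm norm_minus_commute)
  qed
  then have AV: "A \<subseteq> V" using t by blast
  have Anz: "z \<noteq> m" if "z \<in> A" for z using that \<open>d > 0\<close> by (auto simp: AD)
  have conA: "connected A"
    unfolding A_def by (intro connected_complement_bounded_convex) auto
  have cs0: "continuous_on V s0"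
    unfolding s0_def by (intro continuous_intros t)
  have pos: "Re ((s0 z / (z - m)) ^ 2) > 0" if "z \<in> A" for z
  proof -
    have u: "norm (z - m) \<ge> 3 * d" "z \<noteq> m" using that AD Anz by auto
    have "(s0 z / (z - m)) ^ 2 = 1 - \<beta> / (z - m) ^ 2"
      using s0[of z] that AV pq u by (auto simp: power_divide diff_divide_distrib)
    moreover have "norm (\<beta> / (z - m) ^ 2) < 1"
    proof -
      have "(3 * d)\<^sup>2 \<le> norm (z - m) ^ 2" using u \<open>d > 0\<close> by (intro power_mono) auto
      moreover have "d\<^sup>2 / 4 < (3 * d)\<^sup>2" using \<open>d > 0\<close> by (simp add: power_mult_distrib)
      ultimately have "norm \<beta> < norm (z - m) ^ 2" using n\<beta> by linarith
      then show ?thesis using u by (simp add: norm_divide norm_power)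
    qed
    ultimately show ?thesis using complex_Re_le_cmod[of "\<beta> / (z - m) ^ 2"] by simp
  qed
  obtain c :: complex where c: "c = 1 \<or> c = - 1" "\<And>z. z \<in> A \<Longrightarrow> Re (c * s0 z / (z - m)) > 0"
    using branch_sign[OF conA continuous_on_subset[OF cs0 AV] Anz pos] by blast
  define s where "s z = c * s0 z" for z
  have s: "s z ^ 2 = (z - m) ^ 2 - \<beta>" if "z \<in> V" for z
    using s0[OF that] c(1) pq[of z] by (auto simp: s_def power_mult_distrib)
  define g where "g z = (- 2 / \<beta>) * (s z - (z - m))" for z
  have far: "norm (s z + (z - m)) \<ge> norm (z - m)" "g z = 2 / (s z + (z - m))" "s z + (z - m) \<noteq> 0" if "z \<in> A" for z
  proof -
    have "s z + (z - m) = (z - m) * (1 + s z / (z - m))" using Anz[OF that] by (simp add: field_simps)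
    moreover have "norm (1 + s z / (z - m)) \<ge> 1"
      using c(2)[OF that] complex_Re_le_cmod[of "1 + s z / (z - m)"] by (simp add: s_def)
    ultimately show 1: "norm (s z + (z - m)) \<ge> norm (z - m)"
      by (metis mult.right_neutral mult_left_mono norm_ge_zero norm_mult)
    then show nz: "s z + (z - m) \<noteq> 0" using Anz[OF that] by auto
    have "(s z - (z - m)) * (s z + (z - m)) = - \<beta>"
      using s[of z] that AV by (auto simp: algebra_simps power2_eq_square)
    then have "s z - (z - m) = - \<beta> / (s z + (z - m))"
      using nz by (metis nonzero_mult_div_cancel_right)
    then show "g z = 2 / (s z + (z - m))"
      using \<open>\<beta> \<noteq> 0\<close> by (simp add: g_def)
  qed
  have g2: "norm (g z) \<le> 2 / norm (z - m)" if "z \<in> A" for z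
    using far(1,2)[OF that] Anz[OF that] by (simp add: norm_divide frac_le)
  have g3: "norm (g z - 1 / (z - m)) \<le> d\<^sup>2 / (4 * norm (z - m) ^ 3)" if "z \<in> A" for z
  proof -
    let ?u = "z - m" and ?v = "s z + (z - m)"
    have nz: "?u \<noteq> 0" "?v \<noteq> 0" using Anz[OF that] far(3)[OF that] by auto
    have "(?u - s z) * ?v = \<beta>" using s[of z] that AV by (auto simp: algebra_simps power2_eq_square)
    then have "?u - s z = \<beta> / ?v" using nz by (metis nonzero_mult_div_cancel_right)
    moreover have "2 / ?v - 1 / ?u = (?u - s z) / (?v * ?u)"
      using nz by (simp add: divide_simps)
    ultimately have "g z - 1 / ?u = \<beta> / (?v * ?v * ?u)"
      using far(2)[OF that] by (simp add: mult.assoc)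
    then have "norm (g z - 1 / ?u) = d\<^sup>2 / 4 / (norm ?v * norm ?v * norm ?u)"
      by (simp add: norm_divide norm_mult n\<beta>)
    also have "\<dots> \<le> d\<^sup>2 / 4 / (norm ?u * norm ?u * norm ?u)"
      using far(1)[OF that] nz by (intro divide_left_mono mult_mono) auto
    also have "\<dots> = d\<^sup>2 / (4 * norm ?u ^ 3)" by (simp add: power3_eq_cube)
    finally show ?thesis .
  qed
  have g1: "norm (g z) \<le> 52 / d" if "z \<in> V" for z
  proof (cases "z \<in> A")
    case True
    have "2 / norm (z - m) \<le> 2 / (3 * d)" using True \<open>d > 0\<close> by (intro divide_left_mono mult_pos_pos) (auto simp: AD)
    also have "\<dots> \<le> 52 / d" using \<open>d > 0\<close> by (simp add: divide_simps)
    finally show ?thesis using g2[OF True] by simp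
  next
    case False
    \<comment> \<open>Here \<open>z\<close> is within \<open>7 / 2 * d\<close> of both
      \<open>p\<close> and \<open>q\<close>, so \<open>s\<close> has modulus at most
      \<open>7 / 2 * d\<close> and \<open>s - (z - m)\<close> at most \<open>13 / 2 * d\<close>; the
      factor \<open>2 / \<beta>\<close> contributes \<open>8 / d ^ 2\<close>.\<close>
    then have u: "norm (z - m) \<le> 3 * d" by (simp add: AD)
    have "norm (s z) ^ 2 = norm ((z - p) * (z - q))"
      using s[OF that] pq by (metis norm_power)
    also have "\<dots> = norm (z - p) * norm (z - q)" by (simp add: norm_mult)
    also have "\<dots> \<le> (7 / 2 * d) * (7 / 2 * d)"
      using u mp mq norm_triangle_ineq[of "z - m" "m - p"] norm_triangle_ineq[of "z - m" "m - q"]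
      by (intro mult_mono) auto
    finally have "norm (s z) ^ 2 \<le> (7 / 2 * d) ^ 2" by (simp add: power2_eq_square)
    then have "norm (s z) \<le> 7 / 2 * d" by (rule power2_le_imp_le) (use \<open>d > 0\<close> in auto)
    then have "norm (s z - (z - m)) \<le> 13 / 2 * d"
      using u norm_triangle_ineq4[of "s z" "z - m"] by simp
    then have "norm (g z) \<le> norm (- 2 / \<beta>) * (13 / 2 * d)"
      unfolding g_def norm_mult by (intro mult_left_mono) auto
    also have "\<dots> = 52 / d" using \<open>d > 0\<close> by (simp add: norm_divide n\<beta> power2_eq_square field_simps)
    finally show ?thesis .
  qed
  have "poly_approximable K (\<lambda>z. (- 2 / \<beta>) * (c * ((z + - p) * t z) + (- 1) * (z + - m)))"
    using K(1) t(4) by (intro poly_approximable_cmult poly_approximable_add poly_approximable_mult) auto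
  moreover have "g = (\<lambda>z. (- 2 / \<beta>) * (c * ((z + - p) * t z) + (- 1) * (z + - m)))"
    by (auto simp: g_def s_def s0_def)
  ultimately have "poly_approximable K g" by simp
  moreover have "continuous_on V g"
    unfolding g_def s_def by (intro continuous_intros cs0)
  ultimately show ?thesis
    using that[of g V m] t(1,2) mp g1 g2 g3 AD by (auto simp: L_def)
qed

section \<open>Integrals over the boundaries of rectangles\<close>

text \<open>Horizontal and vertical edges are kept apart and all run in the positive coordinate
  direction, so that an edge shared by two squares yields the same term with opposite signs.\<close>

definition hseg_integral :: "(complex \<Rightarrow> complex) \<Rightarrow> real \<Rightarrow> real \<Rightarrow> real \<Rightarrow> complex" where
  "hseg_integral h y a b = contour_integral (linepath (Complex a y) (Complex b y)) h"

definition vseg_integral :: "(complex \<Rightarrow> complex) \<Rightarrow> real \<Rightarrow> real \<Rightarrow> real \<Rightarrow> complex" where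
  "vseg_integral h x a b = contour_integral (linepath (Complex x a) (Complex x b)) h"

definition rect_integral :: "(complex \<Rightarrow> complex) \<Rightarrow> real \<Rightarrow> real \<Rightarrow> real \<Rightarrow> real \<Rightarrow> complex" where
  "rect_integral h a b c e = contour_integral (rectpath (Complex a c) (Complex b e)) h"

lemma hseg_in_segment: "w \<in> closed_segment (Complex a y) (Complex b y) \<longleftrightarrow> Im w = y \<and> Re w \<in> closed_segment a b"
  by (auto simp: closed_segment_same_Im)

lemma vseg_in_segment: "w \<in> closed_segment (Complex x a) (Complex x b) \<longleftrightarrow> Re w = x \<and> Im w \<in> closed_segment a b"
  by (auto simp: closed_segment_same_Re)

lemma rectpath_segments:
  "path_image (rectpath (Complex a c) (Complex b e)) =
     closed_segment (Complex a c) (Complex b c) \<union> closed_segment (Complex b c) (Complex b e) \<union>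
     closed_segment (Complex a e) (Complex b e) \<union> closed_segment (Complex a c) (Complex a e)"
  by (auto simp: rectpath_def Let_def path_image_join closed_segment_commute)

lemma has_contour_integral_rectpath:
  assumes "continuous_on (path_image (rectpath (Complex a c) (Complex b e))) h"
  shows "(h has_contour_integral (hseg_integral h c a b + vseg_integral h b c e - hseg_integral h e a b - vseg_integral h a c e))
           (rectpath (Complex a c) (Complex b e))"
proof -
  have *: "(h has_contour_integral contour_integral (linepath x y) h) (linepath x y)"
    "(h has_contour_integral (- contour_integral (linepath x y) h)) (linepath y x)"
    if "closed_segment x y \<subseteq> path_image (rectpath (Complex a c) (Complex b e))" for x y
  proof -
    have i: "continuous_on (closed_segment x y) h"
      using assms that continuous_on_subset by blast
    then show 1: "(h has_contour_integral contour_integral (linepath x y) h) (linepath x y)"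
      by (intro has_contour_integral_integral contour_integrable_continuous_linepath)
    show "(h has_contour_integral (- contour_integral (linepath x y) h)) (linepath y x)"
      using has_contour_integral_reversepath[OF _ 1] by simp
  qed
  have "(h has_contour_integral (hseg_integral h c a b + (vseg_integral h b c e + (- hseg_integral h e a b + - vseg_integral h a c e))))
           (rectpath (Complex a c) (Complex b e))"
    unfolding rectpath_def Let_def hseg_integral_def vseg_integral_def complex.sel
    by (intro has_contour_integral_join *) (auto simp: rectpath_segments)
  then show ?thesis by (simp add: algebra_simps)
qed

lemma rect_integral_segments:
  assumes "continuous_on (path_image (rectpath (Complex a c) (Complex b e))) h"
  shows "rect_integral h a b c e = hseg_integral h c a b + vseg_integral h b c e - hseg_integral h e a b - vseg_integral h a c e"
  unfolding rect_integral_def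
  by (rule contour_integral_unique[OF has_contour_integral_rectpath[OF assms]])

lemma contour_integrable_rectpath:
  assumes "continuous_on (path_image (rectpath (Complex a c) (Complex b e))) h"
  shows "h contour_integrable_on (rectpath (Complex a c) (Complex b e))"
  using has_contour_integral_rectpath[OF assms] by (auto simp: contour_integrable_on_def)

lemma norm_rect_integral_le:
  assumes h: "continuous_on (path_image (rectpath (Complex a c) (Complex b e))) h"
    and B: "\<And>w. w \<in> path_image (rectpath (Complex a c) (Complex b e)) \<Longrightarrow> norm (h w) \<le> B"
    and "a \<le> b" "c \<le> e" "B \<ge> 0"
  shows "norm (rect_integral h a b c e) \<le> B * (2 * (b - a) + 2 * (e - c))"
proof -
  have *: "norm (contour_integral (linepath x y) h) \<le> B * norm (y - x)"
    if "closed_segment x y \<subseteq> path_image (rectpath (Complex a c) (Complex b e))" for x y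
    using that h B \<open>B \<ge> 0\<close>
    by (intro contour_integral_bound_linepath contour_integrable_continuous_linepath)
      (auto intro: continuous_on_subset)
  have n: "norm (Complex b y - Complex a y) = b - a" "norm (Complex x e - Complex x c) = e - c" for x y
    using assms(3,4) by (simp_all add: norm_complex_def)
  have "norm (hseg_integral h c a b) \<le> B * (b - a)" "norm (hseg_integral h e a b) \<le> B * (b - a)"
    "norm (vseg_integral h b c e) \<le> B * (e - c)" "norm (vseg_integral h a c e) \<le> B * (e - c)"
    unfolding hseg_integral_def vseg_integral_def
    using *[of "Complex a c" "Complex b c"] *[of "Complex a e" "Complex b e"]
      *[of "Complex b c" "Complex b e"] *[of "Complex a c" "Complex a e"]
    by (auto simp: rectpath_segments n)
  moreover have "norm (p + q - r - s) \<le> norm p + norm q + norm r + norm s" for p q r s :: complex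
    by (meson norm_triangle_ineq norm_triangle_ineq4 norm_triangle_le add_mono order_refl order_trans)
  ultimately show ?thesis
    unfolding rect_integral_segments[OF h] by (smt (verit) distrib_left)
qed

lemma rect_integral_add:
  assumes "continuous_on (path_image (rectpath (Complex a c) (Complex b e))) f"
    and "continuous_on (path_image (rectpath (Complex a c) (Complex b e))) g"
  shows "rect_integral (\<lambda>w. f w + g w) a b c e = rect_integral f a b c e + rect_integral g a b c e"
  unfolding rect_integral_def by (intro contour_integral_add contour_integrable_rectpath assms)

lemma rect_integral_diff:
  assumes "continuous_on (path_image (rectpath (Complex a c) (Complex b e))) f"
    and "continuous_on (path_image (rectpath (Complex a c) (Complex b e))) g"
  shows "rect_integral (\<lambda>w. f w - g w) a b c e = rect_integral f a b c e - rect_integral g a b c e"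
  unfolding rect_integral_def by (intro contour_integral_diff contour_integrable_rectpath assms)

lemma rect_integral_rmul:
  assumes "continuous_on (path_image (rectpath (Complex a c) (Complex b e))) f"
  shows "rect_integral (\<lambda>w. f w * x) a b c e = rect_integral f a b c e * x"
  unfolding rect_integral_def by (intro contour_integral_rmul contour_integrable_rectpath assms)

lemma rect_integral_holomorphic:
  assumes "f holomorphic_on cbox (Complex a c) (Complex b e)" "a \<le> b" "c \<le> e"
  shows "rect_integral f a b c e = 0"
  unfolding rect_integral_def
  by (rule contour_integral_unique, rule Cauchy_theorem_convex_simple[OF assms(1)])
    (use assms path_image_rectpath_subset_cbox[of "Complex a c" "Complex b e"] in auto)

lemma rect_integral_cauchy:
  assumes f: "f holomorphic_on cbox (Complex a c) (Complex b e)" and z: "z \<in> box (Complex a c) (Complex b e)"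
  shows "rect_integral (\<lambda>w. f w / (w - z)) a b c e = 2 * of_real pi * \<i> * f z"
proof -
  have ab: "a < b" "c < e" using z by (auto simp: in_box_complex_iff)
  have "((\<lambda>w. f w / (w - z)) has_contour_integral of_real (2 * pi) * \<i> * winding_number (rectpath (Complex a c) (Complex b e)) z * f z)
      (rectpath (Complex a c) (Complex b e))"
    by (rule Cauchy_integral_formula_convex_simple[OF convex_box(1) f])
      (use z ab path_image_rectpath_subset_cbox[of "Complex a c" "Complex b e"]
          path_image_rectpath_inter_box[of "Complex a c" "Complex b e"] in \<open>auto simp: interior_cbox\<close>)
  then show ?thesis
    unfolding rect_integral_def using winding_number_rectpath[OF z] contour_integral_unique by fastforce
qed

section \<open>Cancellation of inner edges in a grid\<close>

definition grid_lines :: "real \<Rightarrow> complex set" where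
  "grid_lines d = {z. \<exists>j::int. Re z = d * j \<or> Im z = d * j}"

abbreviation grid_rect_integral :: "(complex \<Rightarrow> complex) \<Rightarrow> real \<Rightarrow> int \<Rightarrow> int \<Rightarrow> int \<Rightarrow> int \<Rightarrow> complex" where
  "grid_rect_integral h d a b c e \<equiv> rect_integral h (d * a) (d * b) (d * c) (d * e)"

lemma grid_rectpath_subset:
  "path_image (rectpath (Complex (d * of_int a) (d * of_int c)) (Complex (d * of_int b) (d * of_int e))) \<subseteq> grid_lines d"
  by (auto simp: rectpath_segments hseg_in_segment vseg_in_segment grid_lines_def)

lemma sum_telescope_int:
  fixes F :: "int \<Rightarrow> 'a::ab_group_add"
  assumes "a \<le> b"
  shows "(\<Sum>j\<in>{a..<b}. F (j + 1) - F j) = F b - F a"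
  using assms
proof (induction b rule: int_ge_induct)
  case (step i)
  have "{a..<i + 1} = insert i {a..<i}" using step by auto
  then show ?case using step by simp
qed simp

lemma hseg_integral_sum:
  assumes h: "continuous_on (grid_lines d) h" and "a \<le> b" "d > 0"
  shows "(\<Sum>j\<in>{a..<b}. hseg_integral h (d * of_int k) (d * of_int j) (d * of_int (j + 1))) =
         hseg_integral h (d * of_int k) (d * of_int a) (d * of_int b)"
  using \<open>a \<le> b\<close>
proof (induction b rule: int_ge_induct)
  case (step i)
  have "{a..<i + 1} = insert i {a..<i}" using step by auto
  moreover have "hseg_integral h (d * of_int k) (d * of_int a) (d * of_int (i + 1)) =
    hseg_integral h (d * of_int k) (d * of_int a) (d * of_int i) + hseg_integral h (d * of_int k) (d * of_int i) (d * of_int (i + 1))"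
    unfolding hseg_integral_def
  proof (rule contour_integral_split_linepath)
    show "continuous_on (closed_segment (Complex (d * of_int a) (d * of_int k)) (Complex (d * of_int (i + 1)) (d * of_int k))) h"
      by (rule continuous_on_subset[OF h]) (auto simp: hseg_in_segment grid_lines_def)
    show "Complex (d * of_int i) (d * of_int k) \<in> closed_segment (Complex (d * of_int a) (d * of_int k)) (Complex (d * of_int (i + 1)) (d * of_int k))"
      using step \<open>d > 0\<close> by (auto simp: hseg_in_segment closed_segment_eq_real_ivl intro!: mult_left_mono)
  qed
  ultimately show ?case using step by simp
qed (simp add: hseg_integral_def)

lemma vseg_integral_sum:
  assumes h: "continuous_on (grid_lines d) h" and "a \<le> b" "d > 0"
  shows "(\<Sum>j\<in>{a..<b}. vseg_integral h (d * of_int k) (d * of_int j) (d * of_int (j + 1))) =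
         vseg_integral h (d * of_int k) (d * of_int a) (d * of_int b)"
  using \<open>a \<le> b\<close>
proof (induction b rule: int_ge_induct)
  case (step i)
  have "{a..<i + 1} = insert i {a..<i}" using step by auto
  moreover have "vseg_integral h (d * of_int k) (d * of_int a) (d * of_int (i + 1)) =
    vseg_integral h (d * of_int k) (d * of_int a) (d * of_int i) + vseg_integral h (d * of_int k) (d * of_int i) (d * of_int (i + 1))"
    unfolding vseg_integral_def
  proof (rule contour_integral_split_linepath)
    show "continuous_on (closed_segment (Complex (d * of_int k) (d * of_int a)) (Complex (d * of_int k) (d * of_int (i + 1)))) h"
      by (rule continuous_on_subset[OF h]) (auto simp: vseg_in_segment grid_lines_def)
    show "Complex (d * of_int k) (d * of_int i) \<in> closed_segment (Complex (d * of_int k) (d * of_int a)) (Complex (d * of_int k) (d * of_int (i + 1)))"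
      using step \<open>d > 0\<close> by (auto simp: vseg_in_segment closed_segment_eq_real_ivl intro!: mult_left_mono)
  qed
  ultimately show ?case using step by simp
qed (simp add: vseg_integral_def)

text \<open>Every inner edge belongs to two squares and is traversed once in each direction, so only
  the outer boundary remains.\<close>

lemma grid_rect_integral_sum:
  assumes h: "continuous_on (grid_lines d) h" and "a \<le> b" "c \<le> e" "d > 0"
  shows "(\<Sum>j\<in>{a..<b}. \<Sum>k\<in>{c..<e}. grid_rect_integral h d j (j + 1) k (k + 1)) = grid_rect_integral h d a b c e"
proof -
  define H where "H k j j' = hseg_integral h (d * of_int k) (d * of_int j) (d * of_int j')" for k j j' :: int
  define V where "V k j j' = vseg_integral h (d * of_int k) (d * of_int j) (d * of_int j')" for k j j' :: int
  have r: "grid_rect_integral h d j j' k k' = H k j j' + V j' k k' - H k' j j' - V j k k'" for j j' k k'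
    unfolding H_def V_def
    by (rule rect_integral_segments[OF continuous_on_subset[OF h grid_rectpath_subset]])
  have Hs: "(\<Sum>j\<in>{a..<b}. H k j (j + 1)) = H k a b" for k
    unfolding H_def using hseg_integral_sum[OF h \<open>a \<le> b\<close> \<open>d > 0\<close>] by simp
  have Vs: "(\<Sum>k\<in>{c..<e}. V j k (k + 1)) = V j c e" for j
    unfolding V_def using vseg_integral_sum[OF h \<open>c \<le> e\<close> \<open>d > 0\<close>] by simp
  \<comment> \<open>Within one column the horizontal edges telescope, while the vertical edges join
    to full sides; those telescope in the sum over the columns.\<close>
  have "(\<Sum>k\<in>{c..<e}. H k j (j + 1) + V (j + 1) k (k + 1) - H (k + 1) j (j + 1) - V j k (k + 1)) =
      H c j (j + 1) - H e j (j + 1) + (V (j + 1) c e - V j c e)" for j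
  proof -
    have "(\<Sum>k\<in>{c..<e}. H k j (j + 1) + V (j + 1) k (k + 1) - H (k + 1) j (j + 1) - V j k (k + 1)) =
      (\<Sum>k\<in>{c..<e}. V (j + 1) k (k + 1)) - (\<Sum>k\<in>{c..<e}. V j k (k + 1)) - (\<Sum>k\<in>{c..<e}. H (k + 1) j (j + 1) - H k j (j + 1))"
      by (simp add: sum.distrib sum_subtractf algebra_simps)
    then show ?thesis
      using Vs sum_telescope_int[OF \<open>c \<le> e\<close>, of "\<lambda>k. H k j (j + 1)"] by simp
  qed
  then have "(\<Sum>j\<in>{a..<b}. \<Sum>k\<in>{c..<e}. grid_rect_integral h d j (j + 1) k (k + 1)) =
    (\<Sum>j\<in>{a..<b}. H c j (j + 1)) - (\<Sum>j\<in>{a..<b}. H e j (j + 1)) + (\<Sum>j\<in>{a..<b}. V (j + 1) c e - V j c e)"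
    unfolding r by (simp add: sum.distrib sum_subtractf)
  also have "\<dots> = grid_rect_integral h d a b c e"
    unfolding r Hs using sum_telescope_int[OF \<open>a \<le> b\<close>, of "\<lambda>j. V j c e"] by simp
  finally show ?thesis .
qed

lemma rect_integral_cong:
  assumes "\<And>w. w \<in> path_image (rectpath (Complex a c) (Complex b e)) \<Longrightarrow> f w = g w"
  shows "rect_integral f a b c e = rect_integral g a b c e"
  unfolding rect_integral_def by (rule contour_integral_eq) (use assms in auto)

section \<open>Mergelyan's theorem\<close>

text \<open>Off the square its part is minus the normalised Cauchy integral, with Laurent expansion
  \<open>c1 / u + c2 / u ^ 2 + ...\<close> in \<open>u = z - m\<close>. Since \<open>g\<close> and
  \<open>g ^ 2\<close> agree with \<open>1 / u\<close> and \<open>1 / u ^ 2\<close> up to third and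
  fourth order, \<open>c1 * g + c2 * g ^ 2\<close> reproduces it up to an inverse cube. The
  estimates hold on a neighbourhood of \<open>K\<close>, which allows a later passage to the limit
  from points outside \<open>K\<close>.\<close>

lemma square_integral_approx:
  assumes K: "compact K" "connected (- K)" and p: "p \<notin> K" and "d > 0"
    and pa: "norm (p - Complex x y) \<le> 3 * d" and f: "continuous_on UNIV f"
    and \<omega>: "\<And>w. norm (w - Complex x y) \<le> 2 * d \<Longrightarrow> norm (f w - f (Complex x y)) \<le> \<omega>"
  obtains G V where "poly_approximable K G" "open V" "K \<subseteq> V" "continuous_on V G"
    "\<forall>z\<in>V. norm (G z) \<le> 15000 * \<omega>"
    "\<forall>z\<in>V. norm (z - Complex x y) \<ge> 15 * d \<longrightarrow>
       norm (- (rect_integral (\<lambda>w. f w / (w - z)) x (x + d) y (y + d) / (2 * pi * \<i>)) - G z)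
         \<le> 500 * \<omega> * d ^ 3 / norm (z - Complex x y) ^ 3"
proof -
  obtain g m V where g: "poly_approximable K g" "open V" "K \<subseteq> V" "continuous_on V g"
    "norm (m - p) \<le> d / 2"
    "\<forall>z\<in>V. norm (g z) \<le> 52 / d"
    "\<forall>z\<in>V. norm (z - m) \<ge> 3 * d \<longrightarrow> norm (g z) \<le> 2 / norm (z - m)"
    "\<forall>z\<in>V. norm (z - m) \<ge> 3 * d \<longrightarrow> norm (g z - 1 / (z - m)) \<le> d\<^sup>2 / (4 * norm (z - m) ^ 3)"
    by (rule exists_approximate_cauchy_kernel[OF K p \<open>d > 0\<close>], rule that, assumption+)
  define a where "a = Complex x y"
  define I where "I h = rect_integral h x (x + d) y (y + d)" for h
  define \<phi> where "\<phi> w = f w - f a" for w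
  define P where "P = path_image (rectpath (Complex x y) (Complex (x + d) (y + d)))"
  have "\<omega> \<ge> 0" using \<omega>[of a] \<open>d > 0\<close> by (simp add: a_def)
  have ma: "norm (m - a) \<le> 7 / 2 * d"
    using g(5) pa norm_triangle_ineq[of "m - p" "p - a"] by (simp add: a_def)
  have Pbox: "P \<subseteq> cbox (Complex x y) (Complex (x + d) (y + d))"
    unfolding P_def using \<open>d > 0\<close> by (intro path_image_rectpath_subset_cbox) auto
  have boxa: "norm (w - a) \<le> 2 * d" if "w \<in> cbox (Complex x y) (Complex (x + d) (y + d))" for w
    using that cmod_le[of "w - a"] by (auto simp: a_def in_cbox_complex_iff)
  have wm: "norm (w - m) \<le> 11 / 2 * d" if "w \<in> P" for w
    using boxa[of w] that Pbox ma norm_triangle_ineq4[of "w - a" "m - a"] by auto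
  have \<phi>b: "norm (\<phi> w) \<le> \<omega>" if "w \<in> P" for w
    using \<omega>[of w] boxa[of w] that Pbox by (auto simp: \<phi>_def a_def)
  have c\<phi>: "continuous_on P \<phi>"
    unfolding \<phi>_def by (intro continuous_intros continuous_on_subset[OF f]) auto
  \<comment> \<open>The perimeter \<open>4 * d\<close> divided by \<open>2 * pi\<close> is less than
    \<open>d\<close>.\<close>
  have Ib: "norm (I h / (2 * pi * \<i>)) \<le> B * d"
    if "continuous_on P h" "\<And>w. w \<in> P \<Longrightarrow> norm (h w) \<le> B" "B \<ge> 0" for h B
  proof -
    have "norm (I h) \<le> B * (2 * ((x + d) - x) + 2 * ((y + d) - y))"
      unfolding I_def using that \<open>d > 0\<close> unfolding P_def by (intro norm_rect_integral_le) auto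
    then have "norm (I h) / (2 * pi) \<le> B * (4 * d) / (2 * pi)"
      by (intro divide_right_mono) (auto simp: algebra_simps)
    also have "\<dots> \<le> B * (4 * d) / (2 * 3)"
      using pi_gt3 \<open>d > 0\<close> \<open>B \<ge> 0\<close> by (intro divide_left_mono) auto
    also have "\<dots> \<le> B * d" using \<open>d > 0\<close> \<open>B \<ge> 0\<close> by simp
    finally show ?thesis by (simp add: norm_divide norm_mult)
  qed
  \<comment> \<open>the first two coefficients of the expansion in powers of \<open>1 / (z - m)\<close>\<close>
  define c1 where "c1 = I \<phi> / (2 * pi * \<i>)"
  define c2 where "c2 = I (\<lambda>w. \<phi> w * (w - m)) / (2 * pi * \<i>)"
  have c1: "norm c1 \<le> \<omega> * d"
    unfolding c1_def using c\<phi> \<phi>b \<open>\<omega> \<ge> 0\<close> by (intro Ib) auto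
  have c2: "norm c2 \<le> \<omega> * (11 / 2 * d) * d"
    unfolding c2_def
  proof (rule Ib)
    show "norm (\<phi> w * (w - m)) \<le> \<omega> * (11 / 2 * d)" if "w \<in> P" for w
      unfolding norm_mult using \<phi>b wm that \<open>\<omega> \<ge> 0\<close> by (intro mult_mono) auto
  qed (use c\<phi> \<open>\<omega> \<ge> 0\<close> \<open>d > 0\<close> in \<open>auto intro!: continuous_intros\<close>)
  define G where "G z = c1 * g z + c2 * g z ^ 2" for z
  have main: "norm (G z) \<le> 15000 * \<omega> \<and> (norm (z - Complex x y) \<ge> 15 * d \<longrightarrow>
       norm (- (rect_integral (\<lambda>w. f w / (w - z)) x (x + d) y (y + d) / (2 * pi * \<i>)) - G z)
         \<le> 500 * \<omega> * d ^ 3 / norm (z - Complex x y) ^ 3)" if "z \<in> V" for z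
  proof (intro conjI impI)
    have "norm (G z) \<le> norm c1 * norm (g z) + norm c2 * norm (g z) ^ 2"
      unfolding G_def by (metis norm_mult norm_power norm_triangle_ineq)
    also have "\<dots> \<le> \<omega> * d * (52 / d) + \<omega> * (11 / 2 * d) * d * (52 / d) ^ 2"
      using c1 c2 bspec[OF g(6) \<open>z \<in> V\<close>] \<open>\<omega> \<ge> 0\<close> \<open>d > 0\<close> by (intro add_mono mult_mono power_mono) auto
    \<comment> \<open>The left-hand side equals \<open>14924 * \<omega>\<close>, from
      \<open>52 + 11 / 2 * 52 ^ 2\<close>.\<close>
    also have "\<dots> \<le> 15000 * \<omega>"
      using \<open>d > 0\<close> \<open>\<omega> \<ge> 0\<close> by (simp add: power2_eq_square)
    finally show "norm (G z) \<le> 15000 * \<omega>" .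
    assume far: "norm (z - Complex x y) \<ge> 15 * d"
    define u where "u = z - m"
    have u1: "norm u \<ge> norm (z - a) - 7 / 2 * d"
      using ma norm_triangle_ineq2[of "z - a" "m - a"] by (simp add: u_def)
    \<comment> \<open>Distance \<open>15 * d\<close> from the corner permits the later change of
      centre from \<open>m\<close> back to \<open>a\<close> at the cost of a factor 2.\<close>
    then have u11: "norm u \<ge> 23 / 2 * d" and u2: "norm u \<ge> norm (z - a) / 2"
      using far \<open>d > 0\<close> by (auto simp: a_def)
    have "u \<noteq> 0" using u11 \<open>d > 0\<close> by auto
    have znot: "z \<notin> cbox (Complex x y) (Complex (x + d) (y + d))"
      using boxa[of z] far \<open>d > 0\<close> by (auto simp: a_def)
    have wz: "w - z \<noteq> 0" if "w \<in> P" for w using that znot Pbox by auto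
    \<comment> \<open>The remainder after two terms of the geometric expansion of
      \<open>1 / (w - z)\<close> in powers of \<open>(w - m) / u\<close>, multiplied by
      \<phi>.\<close>
    define \<psi> where "\<psi> w = \<phi> w * (w - m) ^ 2 / (u ^ 2 * (w - z))" for w
    have split: "f w / (w - z) = 1 / (w - z) * f a - \<phi> w * (1 / u) - \<phi> w * (w - m) * (1 / u ^ 2) + \<psi> w"
      if "w \<in> P" for w
    proof -
      have "f w = f a + \<phi> w" by (simp add: \<phi>_def)
      moreover have "1 / (w - z) = - (1 / u) - (w - m) * (1 / u\<^sup>2) + (w - m) ^ 2 / (u ^ 2 * (w - z))"
      proof -
        have 1: "w - m = u + (w - z)" by (simp add: u_def)
        show ?thesis unfolding 1 using wz[OF that] \<open>u \<noteq> 0\<close> by (simp add: field_simps power2_eq_square)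
      qed
      then have "\<phi> w * (1 / (w - z)) = - \<phi> w * (1 / u) - \<phi> w * (w - m) * (1 / u\<^sup>2) + \<psi> w"
      proof -
        have "\<phi> w * (- A - B * C + D) = - \<phi> w * A - \<phi> w * B * C + \<phi> w * D" for A B C D
          by (simp add: algebra_simps)
        moreover have "\<psi> w = \<phi> w * ((w - m) ^ 2 / (u ^ 2 * (w - z)))" by (simp add: \<psi>_def)
        ultimately show ?thesis using \<open>1 / (w - z) = _\<close> by metis
      qed
      ultimately show ?thesis by (simp add: add_divide_distrib)
    qed
    have c\<psi>: "continuous_on P \<psi>"
      unfolding \<psi>_def using wz \<open>u \<noteq> 0\<close> by (intro continuous_intros c\<phi>) auto
    have cz: "continuous_on P (\<lambda>w. 1 / (w - z))"
      using wz by (intro continuous_intros) auto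
    have "I (\<lambda>w. f w / (w - z)) = I (\<lambda>w. 1 / (w - z) * f a - \<phi> w * (1 / u) - \<phi> w * (w - m) * (1 / u ^ 2) + \<psi> w)"
      unfolding I_def by (rule rect_integral_cong) (use split in \<open>simp add: P_def\<close>)
    also have "\<dots> = I (\<lambda>w. 1 / (w - z)) * f a - I \<phi> * (1 / u) - I (\<lambda>w. \<phi> w * (w - m)) * (1 / u ^ 2) + I \<psi>"
    proof -
      have "I (\<lambda>w. 1 / (w - z) * f a - \<phi> w * (1 / u) - \<phi> w * (w - m) * (1 / u ^ 2) + \<psi> w) =
        I (\<lambda>w. 1 / (w - z) * f a - \<phi> w * (1 / u) - \<phi> w * (w - m) * (1 / u ^ 2)) + I \<psi>"
        unfolding I_def using wz \<open>u \<noteq> 0\<close> c\<phi> c\<psi> cz by (intro rect_integral_add continuous_intros) (auto simp: P_def)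
      also have "I (\<lambda>w. 1 / (w - z) * f a - \<phi> w * (1 / u) - \<phi> w * (w - m) * (1 / u ^ 2)) =
        I (\<lambda>w. 1 / (w - z) * f a - \<phi> w * (1 / u)) - I (\<lambda>w. \<phi> w * (w - m) * (1 / u ^ 2))"
        unfolding I_def using wz \<open>u \<noteq> 0\<close> c\<phi> cz by (intro rect_integral_diff continuous_intros) (auto simp: P_def)
      also have "I (\<lambda>w. 1 / (w - z) * f a - \<phi> w * (1 / u)) = I (\<lambda>w. 1 / (w - z) * f a) - I (\<lambda>w. \<phi> w * (1 / u))"
        unfolding I_def using wz \<open>u \<noteq> 0\<close> c\<phi> cz by (intro rect_integral_diff continuous_intros) (auto simp: P_def)
      also have "I (\<lambda>w. 1 / (w - z) * f a) = I (\<lambda>w. 1 / (w - z)) * f a"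
        unfolding I_def using wz \<open>u \<noteq> 0\<close> cz by (intro rect_integral_rmul) (auto simp: P_def)
      also have "I (\<lambda>w. \<phi> w * (1 / u)) = I \<phi> * (1 / u)"
        unfolding I_def using wz \<open>u \<noteq> 0\<close> c\<phi> by (intro rect_integral_rmul) (auto simp: P_def)
      also have "I (\<lambda>w. \<phi> w * (w - m) * (1 / u ^ 2)) = I (\<lambda>w. \<phi> w * (w - m)) * (1 / u ^ 2)"
        unfolding I_def using wz \<open>u \<noteq> 0\<close> c\<phi> by (intro rect_integral_rmul continuous_intros) (auto simp: P_def)
      finally show ?thesis .
    qed
    also have "I (\<lambda>w. 1 / (w - z)) = 0"
      unfolding I_def using znot \<open>d > 0\<close>
      by (intro rect_integral_holomorphic holomorphic_intros) auto
    finally have eq: "- (I (\<lambda>w. f w / (w - z)) / (2 * pi * \<i>)) = c1 * (1 / u) + c2 * (1 / u ^ 2) - I \<psi> / (2 * pi * \<i>)"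
      unfolding c1_def c2_def by (simp add: divide_simps)
    define N where "N = norm u"
    have N: "N > 0" "N \<ge> 23 / 2 * d" using \<open>u \<noteq> 0\<close> u11 by (auto simp: N_def)
    have \<psi>b: "norm (I \<psi> / (2 * pi * \<i>)) \<le> 61 * \<omega> * d\<^sup>2 / N ^ 3 * d"
    proof (rule Ib[OF c\<psi>])
      show "0 \<le> 61 * \<omega> * d\<^sup>2 / N ^ 3" using \<open>\<omega> \<ge> 0\<close> N by simp
      fix w assume "w \<in> P"
      \<comment> \<open>Since \<open>N \<ge> 23 / 2 * d\<close>, the distance
        \<open>11 / 2 * d\<close> of \<open>w\<close> from \<open>m\<close> is less than
        \<open>N / 2\<close>.\<close>
      have "norm (w - z) \<ge> N / 2"
        using wm[OF \<open>w \<in> P\<close>] N \<open>d > 0\<close> norm_triangle_ineq2[of u "w - m"] by (simp add: u_def N_def norm_minus_commute)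
      then have "norm (\<psi> w) \<le> \<omega> * (11 / 2 * d) ^ 2 / (N ^ 2 * (N / 2))"
        unfolding \<psi>_def norm_divide norm_mult norm_power N_def[symmetric]
        using \<phi>b[OF \<open>w \<in> P\<close>] wm[OF \<open>w \<in> P\<close>] N \<open>\<omega> \<ge> 0\<close> \<open>d > 0\<close>
        by (intro frac_le mult_mono power_mono mult_left_mono) auto
      also have "\<dots> \<le> 61 * \<omega> * d\<^sup>2 / N ^ 3"
        using N \<open>\<omega> \<ge> 0\<close> \<open>d > 0\<close> by (simp add: power2_eq_square power3_eq_cube divide_simps)
      finally show "norm (\<psi> w) \<le> 61 * \<omega> * d\<^sup>2 / N ^ 3" .
    qed
    have g8: "norm (1 / u - g z) \<le> d\<^sup>2 / (4 * N ^ 3)" and g7: "norm (g z) \<le> 2 / N"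
      using bspec[OF g(7) \<open>z \<in> V\<close>] bspec[OF g(8) \<open>z \<in> V\<close>] u11 \<open>d > 0\<close> by (auto simp: u_def N_def norm_minus_commute)
    have "norm (1 / u + g z) \<le> 3 / N"
      using norm_triangle_ineq[of "1 / u" "g z"] g7 by (simp add: norm_divide N_def add_divide_distrib[symmetric])
    then have "norm (1 / u - g z) * norm (1 / u + g z) \<le> d\<^sup>2 / (4 * N ^ 3) * (3 / N)"
      using g8 N by (intro mult_mono) auto
    moreover have "(1 / u - g z) * (1 / u + g z) = 1 / u ^ 2 - g z ^ 2"
      by (simp add: algebra_simps power2_eq_square)
    ultimately have g9: "norm (1 / u ^ 2 - g z ^ 2) \<le> d\<^sup>2 / (4 * N ^ 3) * (3 / N)"
      by (metis norm_mult)
    have "- (I (\<lambda>w. f w / (w - z)) / (2 * pi * \<i>)) - G z =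
      c1 * (1 / u - g z) + c2 * (1 / u ^ 2 - g z ^ 2) - I \<psi> / (2 * pi * \<i>)"
      unfolding eq G_def by (simp add: algebra_simps)
    moreover have "norm (b + c - e) \<le> norm b + norm c + norm e" for b c e :: complex
      using norm_triangle_ineq4[of "b + c" e] norm_triangle_ineq[of b c] by linarith
    ultimately have "norm (- (I (\<lambda>w. f w / (w - z)) / (2 * pi * \<i>)) - G z) \<le>
      norm c1 * norm (1 / u - g z) + norm c2 * norm (1 / u ^ 2 - g z ^ 2) + norm (I \<psi> / (2 * pi * \<i>))"
      by (simp only: norm_mult[symmetric])
    also have "\<dots> \<le> \<omega> * d * (d\<^sup>2 / (4 * N ^ 3)) + \<omega> * (11 / 2 * d) * d * (d\<^sup>2 / (4 * N ^ 3) * (3 / N)) + 61 * \<omega> * d\<^sup>2 / N ^ 3 * d"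
      using c1 c2 g8 g9 \<psi>b N \<open>\<omega> \<ge> 0\<close> \<open>d > 0\<close> by (intro add_mono mult_mono) auto
    also have "\<dots> = \<omega> * d ^ 3 / N ^ 3 * (1 / 4 + 33 / 8 * (d / N) + 61)"
      using N by (simp add: power2_eq_square power3_eq_cube field_simps)
    also have "\<dots> \<le> \<omega> * d ^ 3 / N ^ 3 * (125 / 2)"
    proof (rule mult_left_mono)
      have "d / N \<le> 2 / 23" using N \<open>d > 0\<close> by (simp add: divide_simps)
      then show "1 / 4 + 33 / 8 * (d / N) + 61 \<le> 125 / 2" by simp
    qed (use \<open>\<omega> \<ge> 0\<close> \<open>d > 0\<close> N in auto)
    \<comment> \<open>Halving the distance costs \<open>2 ^ 3\<close>, and
      \<open>8 * 125 / 2 = 500\<close>.\<close>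
    also have "\<dots> \<le> \<omega> * d ^ 3 / (norm (z - a) / 2) ^ 3 * (125 / 2)"
    proof (rule mult_right_mono)
      have "norm (z - a) > 0" using far \<open>d > 0\<close> by (auto simp: a_def)
      then show "\<omega> * d ^ 3 / N ^ 3 \<le> \<omega> * d ^ 3 / (norm (z - a) / 2) ^ 3"
        using u2 N \<open>\<omega> \<ge> 0\<close> \<open>d > 0\<close> by (intro divide_left_mono power_mono mult_pos_pos) (auto simp: N_def)
    qed simp
    also have "\<dots> = 500 * \<omega> * d ^ 3 / norm (z - a) ^ 3"
      by (simp add: power_divide)
    finally show "norm (- (rect_integral (\<lambda>w. f w / (w - z)) x (x + d) y (y + d) / (2 * pi * \<i>)) - G z)
         \<le> 500 * \<omega> * d ^ 3 / norm (z - Complex x y) ^ 3"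
      unfolding I_def a_def .
  qed
  have "poly_approximable K G"
    unfolding G_def using K(1) g(1)
    by (intro poly_approximable_add poly_approximable_cmult poly_approximable_power)
  moreover have "continuous_on V G" unfolding G_def by (intro continuous_intros g)
  ultimately show ?thesis using that[of G V] g(2,3) main by blast
qed

section \<open>Decomposition of a function over the squares of a grid\<close>

definition grid_square :: "real \<Rightarrow> int \<Rightarrow> int \<Rightarrow> complex set" where
  "grid_square d j k = cbox (Complex (d * j) (d * k)) (Complex (d * (j + 1)) (d * (k + 1)))"

text \<open>Used only for \<open>z\<close> off the grid lines, where the kernel has no pole on the
  contour and exactly one square contains \<open>z\<close>.\<close>

definition grid_part :: "(complex \<Rightarrow> complex) \<Rightarrow> real \<Rightarrow> complex \<Rightarrow> int \<Rightarrow> int \<Rightarrow> complex" where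
  "grid_part f d z j k = (if z \<in> grid_square d j k then f z else 0) -
     grid_rect_integral (\<lambda>w. f w / (w - z)) d j (j + 1) k (k + 1) / (2 * pi * \<i>)"

lemma off_grid_coordinates:
  assumes "d > 0" "z \<notin> grid_lines d"
  shows "d * \<lfloor>Re z / d\<rfloor> < Re z" "Re z < d * (\<lfloor>Re z / d\<rfloor> + 1)"
    "d * \<lfloor>Im z / d\<rfloor> < Im z" "Im z < d * (\<lfloor>Im z / d\<rfloor> + 1)"
proof -
  have *: "d * \<lfloor>x / d\<rfloor> < x \<and> x < d * (\<lfloor>x / d\<rfloor> + 1)" if "\<And>j::int. x \<noteq> d * j" for x
  proof -
    have "x / d < of_int \<lfloor>x / d\<rfloor> + 1" "of_int \<lfloor>x / d\<rfloor> \<le> x / d" by linarith+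
    then have "x < d * (of_int \<lfloor>x / d\<rfloor> + 1)" "d * of_int \<lfloor>x / d\<rfloor> \<le> x"
      using \<open>d > 0\<close> by (metis mult.commute pos_divide_less_eq, metis mult.commute pos_le_divide_eq)
    then show ?thesis using that[of "\<lfloor>x / d\<rfloor>"] by force
  qed
  show "d * \<lfloor>Re z / d\<rfloor> < Re z" "Re z < d * (\<lfloor>Re z / d\<rfloor> + 1)"
    "d * \<lfloor>Im z / d\<rfloor> < Im z" "Im z < d * (\<lfloor>Im z / d\<rfloor> + 1)"
    using *[of "Re z"] *[of "Im z"] assms(2) by (auto simp: grid_lines_def)
qed

lemma grid_square_iff:
  assumes "d > 0" "z \<notin> grid_lines d"
  shows "z \<in> grid_square d j k \<longleftrightarrow> j = \<lfloor>Re z / d\<rfloor> \<and> k = \<lfloor>Im z / d\<rfloor>"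
proof -
  have *: "d * j \<le> x \<and> x \<le> d * (j + 1) \<longleftrightarrow> j = m" if "d * m < x" "x < d * (m + 1)" for x and j m :: int
  proof
    assume h: "d * j \<le> x \<and> x \<le> d * (j + 1)"
    then have "d * j < d * (m + 1)" "d * m < d * (j + 1)" using that by linarith+
    then have "real_of_int j < m + 1" "real_of_int m < j + 1" using \<open>d > 0\<close> by simp_all
    then show "j = m" by linarith
  qed (use that in auto)
  show ?thesis
    using *[OF off_grid_coordinates(1,2)[OF assms], of j] *[OF off_grid_coordinates(3,4)[OF assms], of k]
    by (auto simp: grid_square_def in_cbox_complex_iff)
qed

lemma continuous_on_grid_kernel:
  assumes "continuous_on UNIV f" "z \<notin> grid_lines d"
  shows "continuous_on (grid_lines d) (\<lambda>w. f w / (w - z))"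
  using assms(2) by (intro continuous_intros continuous_on_subset[OF assms(1)]) auto

text \<open>Exactly one square of the block contains \<open>z\<close> and contributes
  \<open>f z\<close>; the integrals add up to the one over the outer boundary.\<close>

lemma grid_part_sum:
  assumes f: "continuous_on UNIV f" and "d > 0" and z: "z \<notin> grid_lines d" and "a \<le> b" "c \<le> e"
    and in1: "\<lfloor>Re z / d\<rfloor> \<in> {a..<b}" and in2: "\<lfloor>Im z / d\<rfloor> \<in> {c..<e}"
  shows "(\<Sum>(j, k)\<in>{a..<b} \<times> {c..<e}. grid_part f d z j k) =
    f z - grid_rect_integral (\<lambda>w. f w / (w - z)) d a b c e / (2 * pi * \<i>)"
proof -
  let ?I = "\<lambda>j k. grid_rect_integral (\<lambda>w. f w / (w - z)) d j (j + 1) k (k + 1)"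
  have "(\<Sum>(j, k)\<in>{a..<b} \<times> {c..<e}. grid_part f d z j k) =
    (\<Sum>q\<in>{a..<b} \<times> {c..<e}. (if q = (\<lfloor>Re z / d\<rfloor>, \<lfloor>Im z / d\<rfloor>) then f z else 0)) -
    (\<Sum>(j, k)\<in>{a..<b} \<times> {c..<e}. ?I j k / (2 * pi * \<i>))"
    by (simp add: sum_subtractf[symmetric] grid_part_def grid_square_iff[OF \<open>d > 0\<close> z] case_prod_beta prod_eq_iff)
  also have "(\<Sum>q\<in>{a..<b} \<times> {c..<e}. (if q = (\<lfloor>Re z / d\<rfloor>, \<lfloor>Im z / d\<rfloor>) then f z else 0)) = f z"
    using in1 in2 by (subst sum.delta) auto
  also have "(\<Sum>(j, k)\<in>{a..<b} \<times> {c..<e}. ?I j k / (2 * pi * \<i>)) =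
    (\<Sum>j\<in>{a..<b}. \<Sum>k\<in>{c..<e}. ?I j k) / (2 * pi * \<i>)"
    by (simp add: sum.cartesian_product[symmetric] sum_divide_distrib)
  also have "(\<Sum>j\<in>{a..<b}. \<Sum>k\<in>{c..<e}. ?I j k) = grid_rect_integral (\<lambda>w. f w / (w - z)) d a b c e"
    by (rule grid_rect_integral_sum[OF continuous_on_grid_kernel[OF f z] \<open>a \<le> b\<close> \<open>c \<le> e\<close> \<open>d > 0\<close>])
  finally show ?thesis .
qed

text \<open>Cauchy's formula when \<open>z\<close> lies in the square, Cauchy's theorem when it does
  not.\<close>

lemma grid_part_eq_0:
  assumes f: "f holomorphic_on grid_square d j k" and "d > 0" and z: "z \<notin> grid_lines d"
  shows "grid_part f d z j k = 0"
proof (cases "z \<in> grid_square d j k")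
  case True
  have "z \<in> box (Complex (d * j) (d * k)) (Complex (d * (j + 1)) (d * (k + 1)))"
    using True off_grid_coordinates[OF \<open>d > 0\<close> z] unfolding grid_square_iff[OF \<open>d > 0\<close> z]
    by (auto simp: in_box_complex_iff)
  then have "grid_rect_integral (\<lambda>w. f w / (w - z)) d j (j + 1) k (k + 1) = 2 * of_real pi * \<i> * f z"
    using f by (intro rect_integral_cauchy) (auto simp: grid_square_def)
  then show ?thesis using True by (simp add: grid_part_def)
next
  case False
  have "grid_rect_integral (\<lambda>w. f w / (w - z)) d j (j + 1) k (k + 1) = 0"
    using f False \<open>d > 0\<close>
    by (intro rect_integral_holomorphic holomorphic_intros) (auto simp: grid_square_def)
  then show ?thesis using False by (simp add: grid_part_def)
qed

text \<open>A single part has no direct bound when \<open>z\<close> is close to an edge. In the sum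
  over a block around \<open>z\<close> the inner edges cancel, and what remains is the Cauchy
  integral of \<open>f w - f z\<close> over a contour far from \<open>z\<close>.\<close>

lemma near_block_bound:
  assumes f: "continuous_on UNIV f" and "d > 0" and z: "z \<notin> grid_lines d"
    and \<omega>: "\<And>w. norm (w - z) \<le> 35 * d \<Longrightarrow> norm (f w - f z) \<le> \<omega>"
    and j0: "j0 = \<lfloor>Re z / d\<rfloor>" and k0: "k0 = \<lfloor>Im z / d\<rfloor>"
  shows "norm (\<Sum>(j, k)\<in>{j0 - 16..<j0 + 17} \<times> {k0 - 16..<k0 + 17}. grid_part f d z j k) \<le> 2 * \<omega>"
proof -
  note o = off_grid_coordinates[OF \<open>d > 0\<close> z, folded j0 k0]
  have "\<omega> \<ge> 0" using \<omega>[of z] \<open>d > 0\<close> by auto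
  let ?J = "\<lambda>h. grid_rect_integral h d (j0 - 16) (j0 + 17) (k0 - 16) (k0 + 17)"
  define P where "P = path_image (rectpath (Complex (d * (j0 - 16)) (d * (k0 - 16))) (Complex (d * (j0 + 17)) (d * (k0 + 17))))"
  have P: "P \<subseteq> grid_lines d"
    using grid_rectpath_subset[of d "j0 - 16" "k0 - 16" "j0 + 17" "k0 + 17"] by (simp add: P_def)
  \<comment> \<open>The square of \<open>z\<close> has 16 further squares on each side, so both
    coordinates differ by at most \<open>17 * d\<close> from those of \<open>w\<close>, and one of
    them by at least \<open>16 * d\<close>.\<close>
  have dist: "16 * d \<le> norm (w - z)" "norm (w - z) \<le> 35 * d" if "w \<in> P" for w
  proof -
    have w: "(Re w \<in> {d * (j0 - 16), d * (j0 + 17)} \<and> Im w \<in> {d * (k0 - 16)..d * (k0 + 17)}) \<or>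
             (Im w \<in> {d * (k0 - 16), d * (k0 + 17)} \<and> Re w \<in> {d * (j0 - 16)..d * (j0 + 17)})"
      using that \<open>d > 0\<close> unfolding P_def by (subst (asm) path_image_rectpath) auto
    have "16 * d \<le> \<bar>Re (w - z)\<bar> \<or> 16 * d \<le> \<bar>Im (w - z)\<bar>"
      using w o by (auto simp: algebra_simps)
    then show "16 * d \<le> norm (w - z)"
      using abs_Re_le_cmod[of "w - z"] abs_Im_le_cmod[of "w - z"] by linarith
    have "\<bar>Re (w - z)\<bar> \<le> 17 * d" "\<bar>Im (w - z)\<bar> \<le> 17 * d"
      using w o \<open>d > 0\<close> by (auto simp: algebra_simps abs_le_iff)
    then show "norm (w - z) \<le> 35 * d" using cmod_le[of "w - z"] \<open>d > 0\<close> by linarith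
  qed
  have c1: "continuous_on P (\<lambda>w. (f w - f z) / (w - z))"
    using P z by (intro continuous_intros continuous_on_subset[OF f]) auto
  have c2: "continuous_on P (\<lambda>w. f z / (w - z))"
    using P z by (intro continuous_intros) auto
  have "?J (\<lambda>w. f w / (w - z)) = ?J (\<lambda>w. (f w - f z) / (w - z) + f z / (w - z))"
    by (simp add: diff_divide_distrib)
  also have "\<dots> = ?J (\<lambda>w. (f w - f z) / (w - z)) + ?J (\<lambda>w. f z / (w - z))"
    using c1 c2 by (intro rect_integral_add) (auto simp: P_def)
  also have "?J (\<lambda>w. f z / (w - z)) = 2 * of_real pi * \<i> * f z"
  proof (rule rect_integral_cauchy)
    show "z \<in> box (Complex (d * (j0 - 16)) (d * (k0 - 16))) (Complex (d * (j0 + 17)) (d * (k0 + 17)))"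
      using o \<open>d > 0\<close> by (auto simp: in_box_complex_iff algebra_simps)
  qed auto
  finally have eq: "?J (\<lambda>w. f w / (w - z)) = ?J (\<lambda>w. (f w - f z) / (w - z)) + 2 * of_real pi * \<i> * f z" .
  have "(\<Sum>(j, k)\<in>{j0 - 16..<j0 + 17} \<times> {k0 - 16..<k0 + 17}. grid_part f d z j k) =
    f z - ?J (\<lambda>w. f w / (w - z)) / (2 * pi * \<i>)"
    by (rule grid_part_sum[OF f \<open>d > 0\<close> z]) (auto simp: j0 k0)
  also have "\<dots> = - (?J (\<lambda>w. (f w - f z) / (w - z)) / (2 * pi * \<i>))"
    unfolding eq by (simp add: add_divide_distrib)
  finally have "norm (\<Sum>(j, k)\<in>{j0 - 16..<j0 + 17} \<times> {k0 - 16..<k0 + 17}. grid_part f d z j k) =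
    norm (?J (\<lambda>w. (f w - f z) / (w - z))) / (2 * pi)"
    by (simp add: norm_divide norm_mult)
  also have "norm (?J (\<lambda>w. (f w - f z) / (w - z))) \<le>
    \<omega> / (16 * d) * (2 * (d * (j0 + 17) - d * (j0 - 16)) + 2 * (d * (k0 + 17) - d * (k0 - 16)))"
  proof (rule norm_rect_integral_le)
    fix w assume "w \<in> path_image (rectpath (Complex (d * (j0 - 16)) (d * (k0 - 16))) (Complex (d * (j0 + 17)) (d * (k0 + 17))))"
    then have "w \<in> P" by (simp add: P_def)
    then show "norm ((f w - f z) / (w - z)) \<le> \<omega> / (16 * d)"
      unfolding norm_divide using \<omega>[of w] dist[of w] \<open>d > 0\<close> \<open>\<omega> \<ge> 0\<close> by (intro frac_le) auto
  qed (use c1 \<open>d > 0\<close> \<open>\<omega> \<ge> 0\<close> in \<open>auto simp: P_def\<close>)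
  \<comment> \<open>The perimeter of the block is \<open>132 * d\<close>, and
    \<open>132 / 16 = 33 / 4\<close>.\<close>
  also have "\<omega> / (16 * d) * (2 * (d * (j0 + 17) - d * (j0 - 16)) + 2 * (d * (k0 + 17) - d * (k0 - 16))) = 33 / 4 * \<omega>"
    using \<open>d > 0\<close> by (simp add: field_simps)
  also have "33 / 4 * \<omega> / (2 * pi) \<le> 33 / 4 * \<omega> / (2 * 3)"
    using pi_gt3 \<open>\<omega> \<ge> 0\<close> by (intro divide_left_mono) auto
  also have "\<dots> \<le> 2 * \<omega>" using \<open>\<omega> \<ge> 0\<close> by simp
  finally show ?thesis by (simp add: divide_right_mono)
qed

section \<open>Summable bounds for distant squares\<close>

text \<open>The exponent shares an inverse cube equally between the two coordinates of a square;
  being larger than 1 in modulus, it makes the double sum a product of two convergent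
  series.\<close>

definition decay :: "int \<Rightarrow> real" where
  "decay i = (real (nat \<bar>i\<bar>) + 1) powr - (3 / 2)"

text \<open>One copy of the series for each direction on the integers.\<close>

definition decay_total :: real where
  "decay_total = 2 * (\<Sum>n. (real n + 1) powr - (3 / 2))"

lemma decay_nonneg [simp]: "decay i \<ge> 0"
  by (simp add: decay_def)

lemma sum_decay_le:
  assumes "finite J"
  shows "(\<Sum>j\<in>J. decay (j - c)) \<le> decay_total"
proof -
  define \<tau> where "\<tau> n = (real n + 1) powr - (3 / 2)" for n
  have "summable (\<lambda>n. real n powr - (3 / 2))"
    by (simp add: summable_real_powr_iff)
  then have s: "summable \<tau>"
    by (subst (asm) summable_Suc_iff[symmetric]) (simp add: \<tau>_def[abs_def] add.commute)
  have *: "(\<Sum>j\<in>A. \<tau> (nat \<bar>j - c\<bar>)) \<le> suminf \<tau>" if "finite A" "inj_on (\<lambda>j. nat \<bar>j - c\<bar>) A" for A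
  proof -
    have "(\<Sum>j\<in>A. \<tau> (nat \<bar>j - c\<bar>)) = sum \<tau> ((\<lambda>j. nat \<bar>j - c\<bar>) ` A)"
      using that by (simp add: sum.reindex)
    also have "\<dots> \<le> suminf \<tau>"
      by (rule sum_le_suminf[OF s]) (use that in \<open>auto simp: \<tau>_def\<close>)
    finally show ?thesis .
  qed
  have "(\<Sum>j\<in>J. decay (j - c)) = (\<Sum>j\<in>J. \<tau> (nat \<bar>j - c\<bar>))"
    by (simp add: decay_def \<tau>_def)
  also have "\<dots> = (\<Sum>j\<in>{j\<in>J. j \<ge> c}. \<tau> (nat \<bar>j - c\<bar>)) + (\<Sum>j\<in>{j\<in>J. \<not> j \<ge> c}. \<tau> (nat \<bar>j - c\<bar>))"
    using assms by (subst sum.union_disjoint[symmetric]) (auto intro!: sum.cong)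
  also have "\<dots> \<le> suminf \<tau> + suminf \<tau>"
    by (intro add_mono *) (use assms in \<open>auto simp: inj_on_def\<close>)
  finally show ?thesis by (simp add: decay_total_def \<tau>_def[abs_def])
qed

lemma inverse_cube_le_decay:
  assumes "\<bar>real_of_int j\<bar> \<le> l" "\<bar>real_of_int k\<bar> \<le> l"
  shows "1 / (l + 1) ^ 3 \<le> decay j * decay k"
proof -
  have "l \<ge> 0" using assms by linarith
  have *: "(l + 1) powr - (3 / 2) \<le> decay i" if "\<bar>real_of_int i\<bar> \<le> l" for i
    unfolding decay_def using that by (intro powr_mono2') auto
  have "1 / (l + 1) ^ 3 = (l + 1) powr - (3 / 2) * (l + 1) powr - (3 / 2)"
    using \<open>l \<ge> 0\<close> by (simp add: powr_add[symmetric] powr_minus_divide)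
  also have "\<dots> \<le> decay j * decay k"
    using * assms by (intro mult_mono) auto
  finally show ?thesis .
qed

text \<open>If the larger index difference is \<open>l\<close>, the corner is at distance at least
  \<open>d * (l - 1)\<close> from \<open>z\<close>. For \<open>l \<ge> 17\<close> this exceeds both
  \<open>15 * d\<close> and \<open>d * (l + 1) / 2\<close>; the 2 in the latter, cubed, turns 500
  into 4000.\<close>

lemma far_square_bound:
  assumes "d > 0" "z \<notin> grid_lines d" "\<omega> \<ge> 0"
    and j0: "j0 = \<lfloor>Re z / d\<rfloor>" and k0: "k0 = \<lfloor>Im z / d\<rfloor>"
    and far: "\<bar>j - j0\<bar> \<ge> 17 \<or> \<bar>k - k0\<bar> \<ge> 17"
  shows "15 * d \<le> norm (z - Complex (d * j) (d * k))"
    and "500 * \<omega> * d ^ 3 / norm (z - Complex (d * j) (d * k)) ^ 3 \<le> 4000 * \<omega> * (decay (j - j0) * decay (k - k0))"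
proof -
  note o = off_grid_coordinates[OF assms(1,2), folded j0 k0]
  define l where "l = real_of_int (max \<bar>j - j0\<bar> \<bar>k - k0\<bar>)"
  have l: "\<bar>real_of_int (j - j0)\<bar> \<le> l" "\<bar>real_of_int (k - k0)\<bar> \<le> l" "l \<ge> 17"
    using far by (auto simp: l_def)
  have *: "d * (\<bar>real_of_int (i - m)\<bar> - 1) \<le> \<bar>x - d * i\<bar>" if "d * m < x" "x < d * (m + 1)" for x and i m :: int
  proof (cases "i \<le> m")
    case True
    then have "d * (\<bar>real_of_int (i - m)\<bar> - 1) \<le> d * (m - i)"
      using \<open>d > 0\<close> by (intro mult_left_mono) auto
    then show ?thesis using that by (simp add: algebra_simps)
  next
    case False
    then have "d * (\<bar>real_of_int (i - m)\<bar> - 1) = d * i - d * (m + 1)"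
      by (simp add: algebra_simps)
    then show ?thesis using that by linarith
  qed
  have "d * (\<bar>real_of_int (j - j0)\<bar> - 1) \<le> norm (z - Complex (d * j) (d * k))"
    "d * (\<bar>real_of_int (k - k0)\<bar> - 1) \<le> norm (z - Complex (d * j) (d * k))"
    using *[OF o(1,2), of j] *[OF o(3,4), of k] abs_Re_le_cmod[of "z - Complex (d * j) (d * k)"]
      abs_Im_le_cmod[of "z - Complex (d * j) (d * k)"] by (auto intro: order_trans)
  then have n: "d * (l - 1) \<le> norm (z - Complex (d * j) (d * k))"
    by (auto simp: l_def max_def)
  moreover have "d * 15 \<le> d * (l - 1)" "d * ((l + 1) / 2) \<le> d * (l - 1)"
    using l \<open>d > 0\<close> by (auto intro!: mult_left_mono)
  ultimately show "15 * d \<le> norm (z - Complex (d * j) (d * k))" by linarith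
  have n2: "d * ((l + 1) / 2) \<le> norm (z - Complex (d * j) (d * k))"
    using n \<open>d * ((l + 1) / 2) \<le> d * (l - 1)\<close> by linarith
  have "500 * \<omega> * d ^ 3 / norm (z - Complex (d * j) (d * k)) ^ 3 \<le> 500 * \<omega> * d ^ 3 / (d * ((l + 1) / 2)) ^ 3"
  proof -
    have "0 < d * ((l + 1) / 2)" using l \<open>d > 0\<close> by simp
    moreover from this n2 have "0 < norm (z - Complex (d * j) (d * k))" by linarith
    ultimately have "0 < norm (z - Complex (d * j) (d * k)) ^ 3 * (d * ((l + 1) / 2)) ^ 3"
      by (metis mult_pos_pos zero_less_power)
    moreover have "(d * ((l + 1) / 2)) ^ 3 \<le> norm (z - Complex (d * j) (d * k)) ^ 3"
      using \<open>0 < d * ((l + 1) / 2)\<close> n2 by (intro power_mono) auto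
    ultimately show ?thesis
      using \<open>d > 0\<close> \<open>\<omega> \<ge> 0\<close> by (intro divide_left_mono) auto
  qed
  also have "\<dots> = 4000 * \<omega> * (1 / (l + 1) ^ 3)"
    using \<open>d > 0\<close> by (simp add: power_mult_distrib power_divide)
  also have "\<dots> \<le> 4000 * \<omega> * (decay (j - j0) * decay (k - k0))"
    using inverse_cube_le_decay[OF l(1,2)] \<open>\<omega> \<ge> 0\<close> by (intro mult_left_mono) auto
  finally show "500 * \<omega> * d ^ 3 / norm (z - Complex (d * j) (d * k)) ^ 3 \<le> 4000 * \<omega> * (decay (j - j0) * decay (k - k0))" .
qed

section \<open>The squares that contribute\<close>

text \<open>On a square that avoids the ball of radius \<open>R\<close> the function vanishes, so it
  is holomorphic there; the ball meets finitely many squares.\<close>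

lemma finite_bad_squares:
  assumes "d > 0" and zero: "\<And>z. norm z \<ge> R \<Longrightarrow> f z = 0"
  shows "finite {(j, k). \<not> f holomorphic_on grid_square d j k}"
proof -
  define M where "M = \<lceil>\<bar>R\<bar> / d\<rceil> + 1"
  have M: "d * (M - 1) \<ge> R"
  proof -
    have "\<bar>R\<bar> / d \<le> of_int \<lceil>\<bar>R\<bar> / d\<rceil>" by linarith
    then have "\<bar>R\<bar> \<le> d * of_int \<lceil>\<bar>R\<bar> / d\<rceil>"
      using \<open>d > 0\<close> by (metis mult.commute pos_divide_le_eq)
    then show ?thesis by (simp add: M_def)
  qed
  have *: "i \<in> {- M..M}" if "d * i \<le> x" "x \<le> d * (i + 1)" "\<bar>x\<bar> < R" for i and x :: real
  proof -
    have "d * i < d * (M - 1)" "d * (- (M - 1)) < d * (i + 1)"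
      using that M by (auto simp: algebra_simps)
    then have "real_of_int i < M - 1" "real_of_int (- (M - 1)) < i + 1"
      using \<open>d > 0\<close> by (simp_all only: mult_less_cancel_left_pos)
    then show ?thesis by simp
  qed
  have "{(j, k). \<not> f holomorphic_on grid_square d j k} \<subseteq> {- M..M} \<times> {- M..M}"
  proof clarify
    fix j k assume bad: "\<not> f holomorphic_on grid_square d j k"
    have "\<exists>w\<in>grid_square d j k. norm w < R"
    proof (rule ccontr)
      assume "\<not> ?thesis"
      then have "f holomorphic_on grid_square d j k \<longleftrightarrow> (\<lambda>_. 0) holomorphic_on grid_square d j k"
        using zero by (intro holomorphic_cong) (auto simp: not_less)
      then show False using bad by simp
    qed
    then obtain w where w: "w \<in> grid_square d j k" "norm w < R" by blast
    then show "j \<in> {- M..M} \<and> k \<in> {- M..M}"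
      using *[of j "Re w"] *[of k "Im w"] abs_Re_le_cmod[of w] abs_Im_le_cmod[of w]
      by (auto simp: grid_square_def in_cbox_complex_iff)
  qed
  then show ?thesis by (rule finite_subset) simp
qed

text \<open>Such a square is not inside the interior of \<open>K\<close>, so it contains a point of
  the closure of the complement. That point is within \<open>2 * d\<close> of the corner, and
  \<open>p\<close> is chosen within \<open>d\<close> of it.\<close>

lemma bad_square_near_complement:
  assumes "d > 0" "f holomorphic_on interior K" "\<not> f holomorphic_on grid_square d j k"
  obtains p where "p \<notin> K" "norm (p - Complex (d * j) (d * k)) \<le> 3 * d"
proof -
  have "\<not> grid_square d j k \<subseteq> interior K"
    using assms holomorphic_on_subset by blast
  then obtain x where x: "x \<in> grid_square d j k" "x \<in> closure (- K)"
    by (auto simp: closure_complement)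
  then obtain p where p: "p \<notin> K" "dist p x < d"
    using \<open>d > 0\<close> closure_approachable by blast
  have "norm (x - Complex (d * j) (d * k)) \<le> 2 * d"
    using x(1) cmod_le[of "x - Complex (d * j) (d * k)"]
    by (auto simp: grid_square_def in_cbox_complex_iff algebra_simps)
  then have "norm (p - Complex (d * j) (d * k)) \<le> 3 * d"
    using p norm_triangle_ineq[of "p - x" "x - Complex (d * j) (d * k)"] by (simp add: dist_norm)
  then show ?thesis using that p by blast
qed

text \<open>The integral over a large square containing the support of \<open>f\<close> vanishes.\<close>

lemma grid_part_total:
  assumes f: "continuous_on UNIV f" and "d > 0" and z: "z \<notin> grid_lines d"
    and zero: "\<And>w. norm w \<ge> R \<Longrightarrow> f w = 0" and "finite B"
    and B: "\<And>j k. (j, k) \<notin> B \<Longrightarrow> grid_part f d z j k = 0"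
  shows "(\<Sum>(j, k)\<in>B. grid_part f d z j k) = f z"
proof -
  define j0 k0 where "j0 = \<lfloor>Re z / d\<rfloor>" and "k0 = \<lfloor>Im z / d\<rfloor>"
  have "finite (fst ` B \<union> snd ` B \<union> {j0, k0, \<lceil>\<bar>R\<bar> / d\<rceil>})" using \<open>finite B\<close> by simp
  \<comment> \<open>The block of side \<open>2 * N\<close> is to contain all squares of
    \<open>B\<close> and the square of \<open>z\<close>, with its boundary outside the ball of
    radius \<open>R\<close>.\<close>
  then obtain N0 where N0: "\<And>i. i \<in> abs ` (fst ` B \<union> snd ` B \<union> {j0, k0, \<lceil>\<bar>R\<bar> / d\<rceil>}) \<Longrightarrow> i \<le> N0"
    by (metis finite_imageI bdd_above_finite bdd_above.E)
  define N where "N = N0 + 1"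
  have N: "\<bar>i\<bar> < N" if "i \<in> fst ` B \<union> snd ` B \<union> {j0, k0, \<lceil>\<bar>R\<bar> / d\<rceil>}" for i
    using N0[of "\<bar>i\<bar>"] that by (auto simp: N_def)
  have "N > 0" using N[of j0] by simp
  have "R \<le> d * N"
  proof -
    have "\<bar>R\<bar> / d \<le> of_int \<lceil>\<bar>R\<bar> / d\<rceil>" by linarith
    also have "\<dots> \<le> N" using N[of "\<lceil>\<bar>R\<bar> / d\<rceil>"] by simp
    finally show ?thesis using \<open>d > 0\<close> by (simp add: pos_divide_le_eq mult.commute)
  qed
  have BN: "B \<subseteq> {-N..<N} \<times> {-N..<N}"
  proof
    fix q assume "q \<in> B"
    then have "\<bar>fst q\<bar> < N" "\<bar>snd q\<bar> < N" by (auto intro!: N)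
    then show "q \<in> {-N..<N} \<times> {-N..<N}" by (cases q) auto
  qed
  have "(\<Sum>(j, k)\<in>B. grid_part f d z j k) = (\<Sum>(j, k)\<in>{-N..<N} \<times> {-N..<N}. grid_part f d z j k)"
    using BN B by (intro sum.mono_neutral_left) auto
  also have "\<dots> = f z - grid_rect_integral (\<lambda>w. f w / (w - z)) d (- N) N (- N) N / (2 * pi * \<i>)"
    using N[of j0] N[of k0] \<open>N > 0\<close>
    by (intro grid_part_sum[OF f \<open>d > 0\<close> z]) (auto simp: j0_def k0_def)
  also have "grid_rect_integral (\<lambda>w. f w / (w - z)) d (- N) N (- N) N = grid_rect_integral (\<lambda>w. 0) d (- N) N (- N) N"
  proof (rule rect_integral_cong)
    fix w assume "w \<in> path_image (rectpath (Complex (d * of_int (- N)) (d * of_int (- N))) (Complex (d * of_int N) (d * of_int N)))"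
    then have "\<bar>Re w\<bar> = d * N \<or> \<bar>Im w\<bar> = d * N"
      using \<open>N > 0\<close> \<open>d > 0\<close> by (subst (asm) path_image_rectpath) auto
    then have "norm w \<ge> R"
      using abs_Re_le_cmod[of w] abs_Im_le_cmod[of w] \<open>R \<le> d * N\<close> by linarith
    then show "f w / (w - z) = 0" using zero by simp
  qed
  also have "\<dots> = 0" by (simp add: rect_integral_def)
  finally show ?thesis by simp
qed

text \<open>A diagonal step increases both coordinates, and neither can be a multiple of
  \<open>d\<close> before it reaches the next multiple above its start.\<close>

lemma off_grid_limit:
  assumes "d > 0"
  shows "eventually (\<lambda>t. z + of_real t * Complex 1 1 \<notin> grid_lines d) (at_right 0)"
proof -
  have *: "eventually (\<lambda>t. \<forall>j::int. x + t \<noteq> d * j) (at_right 0)" for x :: real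
  proof -
    define m where "m = \<lfloor>x / d\<rfloor>"
    have "x / d < of_int m + 1" "of_int m \<le> x / d" unfolding m_def by linarith+
    then have m: "x < d * (m + 1)" "d * m \<le> x"
      using \<open>d > 0\<close> by (simp_all add: pos_divide_less_eq pos_le_divide_eq mult.commute)
    have "x + t \<noteq> d * j" if "t > 0" "t < d * (m + 1) - x" for t and j :: int
    proof
      assume e: "x + t = d * j"
      then have "d * m < d * j" "d * j < d * (m + 1)" using that m by auto
      then have "real_of_int m < j" "real_of_int j < m + 1"
        using \<open>d > 0\<close> by (simp_all only: mult_less_cancel_left_pos)
      then show False by simp
    qed
    then show ?thesis
      unfolding eventually_at_right_field using m
      by (intro exI[of _ "d * (m + 1) - x"]) auto
  qed
  show ?thesis
    using *[of "Re z"] *[of "Im z"] by eventually_elim (auto simp: grid_lines_def)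
qed

section \<open>The quantitative form and the theorem\<close>

text \<open>Collects the errors: \<open>2 + 1089 * 15000\<close>, rounded up, for the near block of
  \<open>33 ^ 2 = 1089\<close> squares, and the double sum over the far squares.\<close>

definition mergelyan_const :: real where
  "mergelyan_const = 17000000 + 4000 * (decay_total * decay_total)"

text \<open>Parts and approximants are compared square by square only far from \<open>z\<close>.
  Near \<open>z\<close> the parts are bounded as a block and the boundedly many approximants one by
  one.\<close>

lemma mergelyan_quantitative:
  assumes K: "compact K" "connected (- K)"
    and f: "continuous_on UNIV f" "f holomorphic_on interior K"
    and zero: "\<And>z. norm z \<ge> R \<Longrightarrow> f z = 0" and "d > 0"
    and \<omega>: "\<And>w z. norm (w - z) \<le> 35 * d \<Longrightarrow> norm (f w - f z) \<le> \<omega>"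
  obtains G where "poly_approximable K G" "\<And>z. z \<in> K \<Longrightarrow> norm (f z - G z) \<le> mergelyan_const * \<omega>"
proof -
  define B where "B = {(j, k). \<not> f holomorphic_on grid_square d j k}"
  have "\<omega> \<ge> 0" using \<omega>[of 0 0] \<open>d > 0\<close> by auto
  have "finite B" unfolding B_def by (rule finite_bad_squares[OF \<open>d > 0\<close> zero])
  define Q where "Q q G V \<longleftrightarrow> poly_approximable K G \<and> open V \<and> K \<subseteq> V \<and> continuous_on V G \<and>
    (\<forall>z\<in>V. norm (G z) \<le> 15000 * \<omega>) \<and>
    (\<forall>z\<in>V. norm (z - Complex (d * real_of_int (fst q)) (d * real_of_int (snd q))) \<ge> 15 * d \<longrightarrow>
       norm (- (grid_rect_integral (\<lambda>w. f w / (w - z)) d (fst q) (fst q + 1) (snd q) (snd q + 1) / (2 * pi * \<i>)) - G z)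
         \<le> 500 * \<omega> * d ^ 3 / norm (z - Complex (d * real_of_int (fst q)) (d * real_of_int (snd q))) ^ 3)" for q G V
  have "\<exists>G V. Q q G V" if "q \<in> B" for q
  proof -
    have "\<not> f holomorphic_on grid_square d (fst q) (snd q)" using that by (auto simp: B_def)
    then obtain p where p: "p \<notin> K" "norm (p - Complex (d * real_of_int (fst q)) (d * real_of_int (snd q))) \<le> 3 * d"
      using bad_square_near_complement[OF \<open>d > 0\<close> f(2)] by blast
    have osc: "norm (f w - f (Complex (d * real_of_int (fst q)) (d * real_of_int (snd q)))) \<le> \<omega>"
      if "norm (w - Complex (d * real_of_int (fst q)) (d * real_of_int (snd q))) \<le> 2 * d" for w
      using that \<open>d > 0\<close> by (intro \<omega>) auto
    have e: "d * real_of_int (i + 1) = d * real_of_int i + d" for i by (simp add: algebra_simps)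
    show ?thesis
      unfolding Q_def e
      by (rule square_integral_approx[OF K p(1) \<open>d > 0\<close> p(2) f(1) osc], assumption, intro exI conjI) assumption+
  qed
  then obtain G V where GVQ: "\<And>q. q \<in> B \<Longrightarrow> Q q (G q) (V q)"
    by metis
  then have GV: "\<And>q. q \<in> B \<Longrightarrow> poly_approximable K (G q)" "\<And>q. q \<in> B \<Longrightarrow> open (V q)"
    "\<And>q. q \<in> B \<Longrightarrow> K \<subseteq> V q" "\<And>q. q \<in> B \<Longrightarrow> continuous_on (V q) (G q)"
    "\<And>q z. q \<in> B \<Longrightarrow> z \<in> V q \<Longrightarrow> norm (G q z) \<le> 15000 * \<omega>"
    "\<And>q z. q \<in> B \<Longrightarrow> z \<in> V q \<Longrightarrow> norm (z - Complex (d * real_of_int (fst q)) (d * real_of_int (snd q))) \<ge> 15 * d \<Longrightarrow>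
       norm (- (grid_rect_integral (\<lambda>w. f w / (w - z)) d (fst q) (fst q + 1) (snd q) (snd q + 1) / (2 * pi * \<i>)) - G q z)
         \<le> 500 * \<omega> * d ^ 3 / norm (z - Complex (d * real_of_int (fst q)) (d * real_of_int (snd q))) ^ 3"
    unfolding Q_def by blast+
  \<comment> \<open>A neighbourhood of \<open>K\<close> is needed because the points off the grid
    that approach a point of \<open>K\<close> may lie outside \<open>K\<close>.\<close>
  define W where "W = (\<Inter>q\<in>B. V q)"
  have "open W"
    unfolding W_def using \<open>finite B\<close> GV(2) by (intro open_INT) auto
  moreover have "K \<subseteq> W"
    unfolding W_def using GV(3) by (rule INT_greatest)
  moreover have "W \<subseteq> V q" if "q \<in> B" for q
    unfolding W_def using that by (rule INT_lower)
  ultimately have W: "open W" "K \<subseteq> W" "\<And>q. q \<in> B \<Longrightarrow> W \<subseteq> V q"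
    by blast+
  define H where "H z = (\<Sum>q\<in>B. G q z)" for z
  have "poly_approximable K H"
    unfolding H_def by (intro poly_approximable_sum GV)
  have cH: "continuous_on W H"
    unfolding H_def by (intro continuous_on_sum continuous_on_subset[OF GV(4) W(3)])
  have off: "norm (f z - H z) \<le> mergelyan_const * \<omega>" if "z \<in> W" and z: "z \<notin> grid_lines d" for z
  proof -
    define j0 k0 where "j0 = \<lfloor>Re z / d\<rfloor>" and "k0 = \<lfloor>Im z / d\<rfloor>"
    define near where "near = {j0 - 16..<j0 + 17} \<times> {k0 - 16..<k0 + 17}"
    define F where "F q = grid_part f d z (fst q) (snd q)" for q
    have F0: "F q = 0" if "q \<notin> B" for q
      using that unfolding F_def by (intro grid_part_eq_0 \<open>d > 0\<close> z) (auto simp: B_def)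
    have fz: "f z = (\<Sum>q\<in>B. F q)"
    proof -
      have "grid_part f d z j k = 0" if "(j, k) \<notin> B" for j k using F0[OF that] by (simp add: F_def)
      from grid_part_total[where R = R, OF f(1) \<open>d > 0\<close> z zero \<open>finite B\<close> this]
      show ?thesis by (simp add: F_def case_prod_beta)
    qed
    have nearF: "norm (\<Sum>q\<in>near. F q) \<le> 2 * \<omega>"
      using near_block_bound[OF f(1) \<open>d > 0\<close> z \<omega> j0_def k0_def]
      by (simp add: F_def near_def case_prod_beta)
    have "finite near" "card near = 1089" by (auto simp: near_def card_cartesian_product)
    \<comment> \<open>Squares outside \<open>B\<close> have vanishing part, so the whole near block
      may be summed and its edges cancel.\<close>
    have "(\<Sum>q\<in>B \<inter> near. F q) = (\<Sum>q\<in>near. F q)"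
      using F0 \<open>finite near\<close> by (intro sum.mono_neutral_left) auto
    moreover have "f z - H z = (\<Sum>q\<in>B. F q - G q z)"
      by (simp add: fz H_def sum_subtractf)
    moreover have "\<dots> = (\<Sum>q\<in>B \<inter> near. F q - G q z) + (\<Sum>q\<in>B - near. F q - G q z)"
      using \<open>finite B\<close> by (subst sum.Int_Diff[of B _ near]) auto
    ultimately have split: "f z - H z = (\<Sum>q\<in>near. F q) - (\<Sum>q\<in>B \<inter> near. G q z) + (\<Sum>q\<in>B - near. F q - G q z)"
      by (simp add: sum_subtractf)
    have n1: "norm (\<Sum>q\<in>B \<inter> near. G q z) \<le> 1089 * (15000 * \<omega>)"
    proof -
      have "norm (\<Sum>q\<in>B \<inter> near. G q z) \<le> (\<Sum>q\<in>B \<inter> near. 15000 * \<omega>)"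
        using GV(5) W(3) \<open>z \<in> W\<close> by (intro sum_norm_le) blast
      also have "\<dots> = card (B \<inter> near) * (15000 * \<omega>)" by simp
      also have "\<dots> \<le> card near * (15000 * \<omega>)"
        using \<open>\<omega> \<ge> 0\<close> \<open>finite near\<close> by (intro mult_right_mono of_nat_mono card_mono) auto
      finally show ?thesis using \<open>card near = 1089\<close> by simp
    qed
    have n2: "norm (\<Sum>q\<in>B - near. F q - G q z) \<le> 4000 * \<omega> * (decay_total * decay_total)"
    proof -
      have "norm (\<Sum>q\<in>B - near. F q - G q z) \<le> (\<Sum>q\<in>B - near. 4000 * \<omega> * (decay (fst q - j0) * decay (snd q - k0)))"
      proof (rule sum_norm_le)
        fix q assume q: "q \<in> B - near"
        obtain j k where jk: "q = (j, k)" by (cases q)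
        have far: "\<bar>j - j0\<bar> \<ge> 17 \<or> \<bar>k - k0\<bar> \<ge> 17"
          using q by (auto simp: jk near_def)
        have zv: "z \<in> V q" using q W(3) \<open>z \<in> W\<close> by blast
        have "z \<notin> grid_square d j k"
          using far grid_square_iff[OF \<open>d > 0\<close> z, of j k] by (auto simp: j0_def k0_def)
        then have "F q = - (grid_rect_integral (\<lambda>w. f w / (w - z)) d j (j + 1) k (k + 1) / (2 * pi * \<i>))"
          by (simp add: F_def grid_part_def jk)
        then have "norm (F q - G q z) \<le> 500 * \<omega> * d ^ 3 / norm (z - Complex (d * j) (d * k)) ^ 3"
          using GV(6)[of q z] q zv far_square_bound(1)[OF \<open>d > 0\<close> z \<open>\<omega> \<ge> 0\<close> j0_def k0_def far]
          by (simp add: jk)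
        also have "\<dots> \<le> 4000 * \<omega> * (decay (j - j0) * decay (k - k0))"
          by (rule far_square_bound(2)[OF \<open>d > 0\<close> z \<open>\<omega> \<ge> 0\<close> j0_def k0_def far])
        finally show "norm (F q - G q z) \<le> 4000 * \<omega> * (decay (fst q - j0) * decay (snd q - k0))"
          by (simp add: jk)
      qed
      also have "\<dots> = 4000 * \<omega> * (\<Sum>q\<in>B - near. decay (fst q - j0) * decay (snd q - k0))"
        by (simp add: sum_distrib_left)
      also have "(\<Sum>q\<in>B - near. decay (fst q - j0) * decay (snd q - k0)) \<le>
        (\<Sum>q\<in>fst ` B \<times> snd ` B. decay (fst q - j0) * decay (snd q - k0))"
        using \<open>finite B\<close> subset_fst_snd[of B] by (intro sum_mono2) auto
      also have "\<dots> = (\<Sum>j\<in>fst ` B. decay (j - j0)) * (\<Sum>k\<in>snd ` B. decay (k - k0))"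
        by (simp add: sum_product sum.cartesian_product case_prod_beta)
      also have "\<dots> \<le> decay_total * decay_total"
        using \<open>finite B\<close> order_trans[OF sum_nonneg sum_decay_le[of "fst ` B" j0]]
        by (intro mult_mono sum_decay_le sum_nonneg) auto
      finally show ?thesis using \<open>\<omega> \<ge> 0\<close> by (simp add: mult_left_mono)
    qed
    have "norm (b - c + e) \<le> norm b + norm c + norm e" for b c e :: complex
      using norm_triangle_ineq[of "b - c" e] norm_triangle_ineq4[of b c] by linarith
    from this[of "\<Sum>q\<in>near. F q" "\<Sum>q\<in>B \<inter> near. G q z" "\<Sum>q\<in>B - near. F q - G q z"]
    have "norm (f z - H z) \<le> 2 * \<omega> + 1089 * (15000 * \<omega>) + 4000 * \<omega> * (decay_total * decay_total)"
      unfolding split using nearF n1 n2 by linarith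
    also have "\<dots> \<le> mergelyan_const * \<omega>"
      using \<open>\<omega> \<ge> 0\<close> by (simp add: mergelyan_const_def algebra_simps)
    finally show ?thesis .
  qed
  \<comment> \<open>points of \<open>K\<close> on the grid lines are reached by a limit along a diagonal\<close>
  have "norm (f z - H z) \<le> mergelyan_const * \<omega>" if "z \<in> K" for z
  proof (rule tendsto_upperbound)
    have "z \<in> W" using that W by auto
    have "((\<lambda>t. z + of_real t * Complex 1 1) \<longlongrightarrow> z + of_real 0 * Complex 1 1) (at_right 0)"
      by (intro tendsto_intros)
    then have lim: "((\<lambda>t. z + of_real t * Complex 1 1) \<longlongrightarrow> z) (at_right 0)" by simp
    have c: "isCont f z" "isCont H z"
      using f(1) cH W(1) \<open>z \<in> W\<close> by (auto simp: continuous_on_eq_continuous_at)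
    show "((\<lambda>t. norm (f (z + of_real t * Complex 1 1) - H (z + of_real t * Complex 1 1))) \<longlongrightarrow> norm (f z - H z)) (at_right 0)"
      by (intro tendsto_norm tendsto_diff isCont_tendsto_compose[OF c(1) lim] isCont_tendsto_compose[OF c(2) lim])
    have "eventually (\<lambda>t. z + of_real t * Complex 1 1 \<in> W) (at_right 0)"
      using topological_tendstoD[OF lim W(1) \<open>z \<in> W\<close>] .
    then show "eventually (\<lambda>t. norm (f (z + of_real t * Complex 1 1) - H (z + of_real t * Complex 1 1)) \<le> mergelyan_const * \<omega>) (at_right 0)"
      using off_grid_limit[OF \<open>d > 0\<close>, of z] by eventually_elim (rule off)
  qed simp
  then show ?thesis using that \<open>poly_approximable K H\<close> by blast
qed

text \<open>Tietze's theorem, applied to \<open>f\<close> on \<open>K\<close> joined with 0 outside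
  a ball that contains \<open>K\<close>.\<close>

lemma continuous_extension_zero_outside:
  fixes f :: "complex \<Rightarrow> complex"
  assumes "compact K" "continuous_on K f"
  obtains F R where "continuous_on UNIV F" "\<And>z. z \<in> K \<Longrightarrow> F z = f z" "\<And>z. norm z \<ge> R \<Longrightarrow> F z = 0"
proof -
  obtain R where R: "\<And>z. z \<in> K \<Longrightarrow> norm z < R" "R > 0"
    using compact_imp_bounded[OF assms(1)] bounded_pos_less by metis
  define g where "g z = (if z \<in> K then f z else 0)" for z
  have cg: "continuous_on (K \<union> - ball 0 R) g"
    unfolding g_def
  proof (rule continuous_on_cases)
    show "\<forall>x. x \<in> K \<and> x \<notin> K \<or> x \<in> - ball 0 R \<and> x \<in> K \<longrightarrow> f x = 0"
      using R by fastforce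
  qed (use assms compact_imp_closed in auto)
  have clo: "closed (K \<union> - ball 0 R)"
    using assms(1) by (intro closed_Un closed_Compl open_ball compact_imp_closed)
  have "bounded (f ` K)"
    using assms compact_continuous_image compact_imp_bounded by blast
  then obtain B where "B > 0" "\<And>z. z \<in> K \<Longrightarrow> norm (f z) \<le> B"
    by (metis bounded_pos imageI)
  then have B: "0 \<le> B" "\<And>z. z \<in> K \<union> - ball 0 R \<Longrightarrow> norm (g z) \<le> B"
    by (auto simp: g_def)
  obtain F where F: "continuous_on UNIV F" "\<And>z. z \<in> K \<union> - ball 0 R \<Longrightarrow> F z = g z"
    by (rule Tietze[OF cg _ B]) (use clo in auto)
  show ?thesis
  proof (rule that[of F R])
    show "F z = f z" if "z \<in> K" for z using F(2)[of z] that by (simp add: g_def)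
    show "F z = 0" if "norm z \<ge> R" for z
      using F(2)[of z] R(1)[of z] that by (auto simp: g_def)
  qed (rule F(1))
qed

lemma uniform_modulus:
  fixes F :: "complex \<Rightarrow> complex"
  assumes F: "continuous_on UNIV F" and zero: "\<And>z. norm z \<ge> R \<Longrightarrow> F z = 0" and "\<omega> > 0"
  obtains h where "h > 0" "\<And>w z. norm (w - z) \<le> h \<Longrightarrow> norm (F w - F z) \<le> \<omega>"
proof -
  have "uniformly_continuous_on (cball 0 (R + 1)) F"
    by (intro compact_uniformly_continuous continuous_on_subset[OF F]) auto
  then obtain d where d: "d > 0"
    "\<And>w z. w \<in> cball 0 (R + 1) \<Longrightarrow> z \<in> cball 0 (R + 1) \<Longrightarrow> dist w z < d \<Longrightarrow> dist (F w) (F z) < \<omega>"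
    using \<open>\<omega> > 0\<close> unfolding uniformly_continuous_on_def by metis
  show ?thesis
  \<comment> \<open>The bound 1 ensures that if one point lies inside radius \<open>R\<close>, both
    lie inside radius \<open>R + 1\<close>, where uniform continuity is known.\<close>
  proof (rule that[of "min 1 (d / 2)"])
    show "norm (F w - F z) \<le> \<omega>" if h: "norm (w - z) \<le> min 1 (d / 2)" for w z
    proof (cases "norm w \<ge> R \<and> norm z \<ge> R")
      case True
      then show ?thesis using zero \<open>\<omega> > 0\<close> by simp
    next
      case False
      then have "norm w \<le> R + 1" "norm z \<le> R + 1"
        using h norm_triangle_ineq2[of w z] norm_triangle_ineq3[of w z] by auto
      then have "dist (F w) (F z) < \<omega>" using h d(1) by (intro d(2)) (auto simp: dist_norm)
      then show ?thesis by (simp add: dist_norm)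
    qed
  qed (use d in auto)
qed

text \<open>The constant depends neither on the function nor on the mesh, so choosing the mesh by
  uniform continuity of the extension makes the error as small as desired.\<close>

theorem mergelyan:
  assumes K: "compact K" "connected (- K)" and f: "continuous_on K f" "f holomorphic_on interior K"
  shows "poly_approximable K f"
proof (rule poly_approximable_limit)
  fix e :: real assume "e > 0"
  obtain F R where F: "continuous_on UNIV F" "\<And>z. z \<in> K \<Longrightarrow> F z = f z" "\<And>z. norm z \<ge> R \<Longrightarrow> F z = 0"
    using continuous_extension_zero_outside[OF K(1) f(1)] by blast
  have "mergelyan_const > 0"
    unfolding mergelyan_const_def by (intro add_pos_nonneg mult_nonneg_nonneg zero_le_square) auto
  define \<omega> where "\<omega> = e / (2 * mergelyan_const)"
  have "\<omega> > 0" using \<open>e > 0\<close> \<open>mergelyan_const > 0\<close> by (simp add: \<omega>_def)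
  obtain h where h: "h > 0" "\<And>w z. norm (w - z) \<le> h \<Longrightarrow> norm (F w - F z) \<le> \<omega>"
    using uniform_modulus[OF F(1,3) \<open>\<omega> > 0\<close>] by blast
  have "F holomorphic_on interior K \<longleftrightarrow> f holomorphic_on interior K"
    using F(2) interior_subset by (intro holomorphic_cong) auto
  then obtain G where G: "poly_approximable K G" "\<And>z. z \<in> K \<Longrightarrow> norm (F z - G z) \<le> mergelyan_const * \<omega>"
    using mergelyan_quantitative[where d = "h / 35" and \<omega> = \<omega> and R = R, OF K F(1) _ F(3)] h f(2) by auto
  have "mergelyan_const * \<omega> < e"
    using \<open>mergelyan_const > 0\<close> \<open>e > 0\<close> by (simp add: \<omega>_def)
  then show "\<exists>h. poly_approximable K h \<and> (\<forall>z\<in>K. norm (f z - h z) < e)"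
    using G F(2) by (metis le_less_trans)
qed

section \<open>Frequent universality\<close>

text \<open>The function equal to 0 near the closed disc and to 1 near \<open>K\<close> is
  holomorphic near their union, so Mergelyan's theorem applies once the union is known to have
  connected complement.\<close>

lemma separating_polynomial:
  fixes K :: "complex set"
  assumes K: "compact K" "K \<subseteq> - cball 0 1" "connected (- K)" and "e > 0"
  obtains w where "poly w 0 = 0" "\<And>z. z \<in> cball 0 1 \<Longrightarrow> norm (poly w z) \<le> e"
    "\<And>z. z \<in> K \<Longrightarrow> norm (poly w z - 1) \<le> e"
proof -
  \<comment> \<open>By compactness a circle of radius \<rho> separates \<open>K\<close> from the
    closed disc.\<close>
  obtain \<rho> where \<rho>: "\<rho> > 1" "\<And>z. z \<in> K \<Longrightarrow> norm z > \<rho>"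
  proof (cases "K = {}")
    case True
    then show ?thesis using that[of 2] by simp
  next
    case False
    obtain x where x: "x \<in> K" "\<And>z. z \<in> K \<Longrightarrow> norm x \<le> norm z"
      using continuous_attains_inf[OF K(1) False, of norm] by (auto intro: continuous_intros)
    then have "norm x > 1" using K(2) by auto
    then show ?thesis using that[of "(1 + norm x) / 2"] x(2) by fastforce
  qed
  define S where "S = ball 0 \<rho> \<union> - cball (0::complex) \<rho>"
  define g where "g z = (if norm z < \<rho> then 0 else 1 :: complex)" for z :: complex
  have "g holomorphic_on ball 0 \<rho>"
    by (rule holomorphic_transform[of "\<lambda>_. 0"]) (auto simp: g_def)
  moreover have "g holomorphic_on - cball 0 \<rho>"
    by (rule holomorphic_transform[of "\<lambda>_. 1"]) (auto simp: g_def)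
  ultimately have gS: "g holomorphic_on S"
    unfolding S_def by (intro holomorphic_on_Un) auto
  have sub: "K \<union> cball 0 1 \<subseteq> S" using \<rho> by (force simp: S_def)
  have disj: "K \<inter> cball 0 1 = {}" using K(2) by auto
  have "connected (- (cball 0 1 :: complex set))"
    by (intro connected_complement_bounded_convex) auto
  \<comment> \<open>Janiszewski's theorem: two disjoint compact sets with connected complements have
    a union with connected complement.\<close>
  then have "connected (- (K \<union> cball 0 1))"
    using K disj by (intro Janiszewski_connected) auto
  moreover have "compact (K \<union> cball 0 1)" using K(1) by auto
  moreover have "continuous_on (K \<union> cball 0 1) g" "g holomorphic_on interior (K \<union> cball 0 1)"
    using holomorphic_on_subset[OF gS sub] holomorphic_on_imp_continuous_on holomorphic_on_subset interior_subset
    by blast+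
  ultimately have "poly_approximable (K \<union> cball 0 1) g"
    by (intro mergelyan)
  then obtain p where p: "\<And>z. z \<in> K \<union> cball 0 1 \<Longrightarrow> norm (g z - poly p z) < e / 2"
    using \<open>e > 0\<close> unfolding poly_approximable_def by (meson half_gt_zero)
  have p0: "norm (poly p 0) < e / 2"
    using p[of 0] \<rho>(1) by (simp add: g_def)
  \<comment> \<open>Subtracting the value at 0 costs the second \<open>e / 2\<close>.\<close>
  define w where "w = p - [:poly p 0:]"
  have w: "poly w z = poly p z - poly p 0" for z by (simp add: w_def)
  show ?thesis
  proof (rule that)
    show "poly w 0 = 0" by (simp add: w)
    show "norm (poly w z) \<le> e" if "z \<in> cball 0 1" for z
      using p[of z] p0 that \<rho>(1) norm_triangle_ineq4[of "poly p z" "poly p 0"] by (auto simp: g_def w)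
    show "norm (poly w z - 1) \<le> e" if "z \<in> K" for z
    proof -
      have "norm (poly p z - 1) < e / 2"
        using p[of z] \<rho>(2)[OF that] that by (auto simp: g_def norm_minus_commute)
      moreover have eq: "poly w z - 1 = (poly p z - 1) - poly p 0" by (simp add: w)
      ultimately show ?thesis
        unfolding eq using p0 norm_triangle_ineq4[of "poly p z - 1" "poly p 0"] by linarith
    qed
  qed
qed

section \<open>Polynomials divisible by a high power of the variable\<close>

definition binomial_tail :: "complex poly \<Rightarrow> nat \<Rightarrow> complex poly" where
  "binomial_tail w M = (\<Sum>k\<in>{M..2 * M}. of_nat (2 * M choose k) * w ^ k * (1 - w) ^ (2 * M - k))"

text \<open>The binomial coefficients of the row sum to \<open>4 ^ M\<close>, and
  \<open>4 / 32 = 1 / 8\<close>.\<close>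

lemma norm_binomial_part_le:
  fixes x :: complex
  assumes "A \<subseteq> {..2 * M}" and A: "\<And>k. k \<in> A \<Longrightarrow> norm (x ^ k * (1 - x) ^ (2 * M - k)) \<le> (1 / 32) ^ M"
  shows "norm (\<Sum>k\<in>A. of_nat (2 * M choose k) * x ^ k * (1 - x) ^ (2 * M - k)) \<le> (1 / 8) ^ M"
proof -
  have "norm (\<Sum>k\<in>A. of_nat (2 * M choose k) * x ^ k * (1 - x) ^ (2 * M - k)) \<le> (\<Sum>k\<in>A. real (2 * M choose k) * (1 / 32) ^ M)"
  proof (rule sum_norm_le)
    fix k assume "k \<in> A"
    have "norm (of_nat (2 * M choose k) * x ^ k * (1 - x) ^ (2 * M - k)) =
      real (2 * M choose k) * norm (x ^ k * (1 - x) ^ (2 * M - k))"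
      by (simp add: norm_mult)
    also have "\<dots> \<le> real (2 * M choose k) * (1 / 32) ^ M"
      using A[OF \<open>k \<in> A\<close>] by (intro mult_left_mono) auto
    finally show "norm (of_nat (2 * M choose k) * x ^ k * (1 - x) ^ (2 * M - k)) \<le> real (2 * M choose k) * (1 / 32) ^ M" .
  qed
  also have "\<dots> \<le> (\<Sum>k\<le>2 * M. real (2 * M choose k) * (1 / 32) ^ M)"
    using assms(1) by (intro sum_mono2) auto
  also have "\<dots> = real (\<Sum>k\<le>2 * M. 2 * M choose k) * (1 / 32) ^ M"
    by (simp add: sum_distrib_right)
  also have "(\<Sum>k\<le>2 * M. 2 * M choose k) = 4 ^ M"
    by (simp add: choose_row_sum power_mult)
  also have "real (4 ^ M) * (1 / 32) ^ M = (4 * (1 / 32)) ^ M"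
    by (simp only: of_nat_power of_nat_numeral power_mult_distrib)
  also have "\<dots> = (1 / 8) ^ M" by simp
  finally show ?thesis .
qed

text \<open>The small factor occurs at least \<open>M\<close> times and the other at most
  \<open>M\<close> times; \<open>2 / 64 = 1 / 32\<close> leaves room for the row sum
  \<open>4 ^ M\<close>.\<close>

lemma norm_power_prod_le:
  fixes x y :: complex
  assumes "norm x \<le> 1 / 64" "norm y \<le> 2" "M \<le> k" "l \<le> M"
  shows "norm (x ^ k * y ^ l) \<le> (1 / 32) ^ M"
proof -
  have "norm x ^ k \<le> norm x ^ M" using assms by (intro power_decreasing) auto
  also have "\<dots> \<le> (1 / 64) ^ M" using assms by (intro power_mono) auto
  finally have 1: "norm x ^ k \<le> (1 / 64) ^ M" .
  have "norm y ^ l \<le> 2 ^ l" using assms by (intro power_mono) auto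
  also have "\<dots> \<le> 2 ^ M" using assms by (intro power_increasing) auto
  finally have 2: "norm y ^ l \<le> 2 ^ M" .
  have "norm (x ^ k * y ^ l) \<le> (1 / 64) ^ M * 2 ^ M"
    unfolding norm_mult norm_power using 1 2 by (intro mult_mono) auto
  also have "\<dots> = (1 / 64 * 2) ^ M" by (simp only: power_mult_distrib)
  finally show ?thesis by simp
qed

lemma poly_binomial_tail:
  "poly (binomial_tail w M) z = (\<Sum>k\<in>{M..2 * M}. of_nat (2 * M choose k) * poly w z ^ k * (1 - poly w z) ^ (2 * M - k))"
  by (simp add: binomial_tail_def poly_sum poly_power)

lemma binomial_tail_near_0:
  assumes "norm (poly w z) \<le> 1 / 64"
  shows "norm (poly (binomial_tail w M) z) \<le> (1 / 8) ^ M"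
proof -
  have "norm (1 - poly w z) \<le> 2" using assms norm_triangle_ineq4[of 1 "poly w z"] by simp
  then show ?thesis
    unfolding poly_binomial_tail using assms
    by (intro norm_binomial_part_le norm_power_prod_le) auto
qed

text \<open>The full expansion equals 1, so the difference is the lower half, in which the small
  factor \<open>1 - w\<close> occurs more than \<open>M\<close> times.\<close>

lemma binomial_tail_near_1:
  assumes "norm (poly w z - 1) \<le> 1 / 64"
  shows "norm (1 - poly (binomial_tail w M) z) \<le> (1 / 8) ^ M"
proof -
  let ?x = "poly w z"
  let ?t = "\<lambda>k. of_nat (2 * M choose k) * ?x ^ k * (1 - ?x) ^ (2 * M - k)"
  have "norm ?x \<le> 2" using assms norm_triangle_ineq2[of ?x 1] by simp
  have "1 = (?x + (1 - ?x)) ^ (2 * M)" by simp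
  also have "\<dots> = (\<Sum>k\<le>2 * M. ?t k)" by (rule binomial_ring)
  also have "{..2 * M} = {..<M} \<union> {M..2 * M}" by auto
  also have "sum ?t \<dots> = sum ?t {..<M} + sum ?t {M..2 * M}" by (rule sum.union_disjoint) auto
  finally have "1 - poly (binomial_tail w M) z = sum ?t {..<M}"
    by (simp add: poly_binomial_tail algebra_simps)
  moreover have "norm (sum ?t {..<M}) \<le> (1 / 8) ^ M"
  proof (rule norm_binomial_part_le)
    fix k assume "k \<in> {..<M}"
    then have "norm ((1 - ?x) ^ (2 * M - k) * ?x ^ k) \<le> (1 / 32) ^ M"
      using assms \<open>norm ?x \<le> 2\<close> by (intro norm_power_prod_le) (auto simp: norm_minus_commute)
    then show "norm (?x ^ k * (1 - ?x) ^ (2 * M - k)) \<le> (1 / 32) ^ M" by (simp add: mult.commute)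
  qed auto
  ultimately show ?thesis by simp
qed

lemma binomial_tail_dvd:
  assumes "poly w 0 = 0"
  shows "monom 1 M dvd binomial_tail w M"
proof -
  have "[:0, 1:] dvd w" using assms by (simp add: poly_eq_0_iff_dvd)
  then have *: "monom 1 M dvd w ^ M"
    by (metis dvd_power_same monom_altdef smult_1_left)
  show ?thesis
    unfolding binomial_tail_def
  proof (rule dvd_sum)
    fix k assume "k \<in> {M..2 * M}"
    then have "monom 1 M dvd w ^ k" using * le_imp_power_dvd dvd_trans by (metis atLeastAtMost_iff)
    then show "monom 1 M dvd of_nat (2 * M choose k) * w ^ k * (1 - w) ^ (2 * M - k)"
      by (intro dvd_mult2 dvd_mult)
  qed
qed

lemma degree_binomial_tail: "degree (binomial_tail w M) \<le> 2 * M * degree w"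
  unfolding binomial_tail_def
proof (rule degree_sum_le)
  fix k assume k: "k \<in> {M..2 * M}"
  have "degree (1 - w) \<le> degree w" by (metis degree_1 degree_diff_le le0 order_refl)
  have "degree (of_nat (2 * M choose k) * w ^ k * (1 - w) ^ (2 * M - k)) \<le>
    degree (of_nat (2 * M choose k) :: complex poly) + degree (w ^ k) + degree ((1 - w) ^ (2 * M - k))"
    by (meson add_mono degree_mult_le order_refl order_trans)
  also have "\<dots> \<le> 0 + degree w * k + degree w * (2 * M - k)"
    using degree_power_le[of w k] degree_power_le[of "1 - w" "2 * M - k"] \<open>degree (1 - w) \<le> degree w\<close>
    by (intro add_mono) (auto intro: order_trans)
  also have "\<dots> = 2 * M * degree w"
  proof -
    have "degree w * k + degree w * (2 * M - k) = degree w * (k + (2 * M - k))"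
      by (simp only: distrib_left)
    then show ?thesis using k by simp
  qed
  finally show "degree (of_nat (2 * M choose k) * w ^ k * (1 - w) ^ (2 * M - k)) \<le> 2 * M * degree w" .
qed simp

section \<open>Enumeration of the targets\<close>

text \<open>Polynomials with coefficients in the Gaussian rationals are countable, and the same
  sequence serves every compact set. The induction peels off the constant term; multiplication by
  \<open>z\<close> costs a factor \<open>R\<close>.\<close>

lemma exists_dense_polynomials:
  obtains e :: "nat \<Rightarrow> complex poly"
  where "\<And>K p \<epsilon>. compact K \<Longrightarrow> \<epsilon> > 0 \<Longrightarrow> \<exists>n. \<forall>z\<in>K. norm (poly (e n) z - poly p z) < \<epsilon>"
proof -
  define P where "P xs = Poly (map (\<lambda>(a, b). Complex (of_rat a) (of_rat b)) xs)" for xs :: "(rat \<times> rat) list"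
  have dense: "\<exists>a b. norm (Complex (of_rat a) (of_rat b) - c) < \<epsilon>" if "\<epsilon> > 0" for c and \<epsilon> :: real
  proof -
    obtain a where a: "Re c < of_rat a" "of_rat a < Re c + \<epsilon> / 2"
      using of_rat_dense[of "Re c" "Re c + \<epsilon> / 2"] \<open>\<epsilon> > 0\<close> by (auto simp del: of_rat_less)
    obtain b where b: "Im c < of_rat b" "of_rat b < Im c + \<epsilon> / 2"
      using of_rat_dense[of "Im c" "Im c + \<epsilon> / 2"] \<open>\<epsilon> > 0\<close> by auto
    have "norm (Complex (of_rat a) (of_rat b) - c) < \<epsilon>"
      using cmod_le[of "Complex (of_rat a) (of_rat b) - c"] a b by auto
    then show ?thesis by blast
  qed
  have main: "\<exists>xs. \<forall>z. norm z \<le> R \<longrightarrow> norm (poly (P xs) z - poly p z) < \<epsilon>" if "R > 0" "\<epsilon> > 0" for R \<epsilon> p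
    using \<open>\<epsilon> > 0\<close>
  proof (induction p arbitrary: \<epsilon>)
    case 0
    then show ?case by (intro exI[of _ "[]"]) (simp add: P_def)
  next
    case (pCons c p)
    obtain a b where ab: "norm (Complex (of_rat a) (of_rat b) - c) < \<epsilon> / 2"
      using dense[of "\<epsilon> / 2" c] pCons by auto
    obtain xs where xs: "\<And>z. norm z \<le> R \<Longrightarrow> norm (poly (P xs) z - poly p z) < \<epsilon> / (2 * R)"
      using pCons.IH[of "\<epsilon> / (2 * R)"] pCons.prems \<open>R > 0\<close> by auto
    show ?case
    proof (intro exI allI impI)
      fix z :: complex assume z: "norm z \<le> R"
      have "norm (z * (poly (P xs) z - poly p z)) \<le> R * (\<epsilon> / (2 * R))"
        unfolding norm_mult using z xs[OF z] \<open>R > 0\<close> by (intro mult_mono) auto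
      also have "\<dots> = \<epsilon> / 2" using \<open>R > 0\<close> by simp
      finally have "norm (z * (poly (P xs) z - poly p z)) \<le> \<epsilon> / 2" .
      moreover have eq: "poly (P ((a, b) # xs)) z - poly (pCons c p) z =
          (Complex (of_rat a) (of_rat b) - c) + z * (poly (P xs) z - poly p z)"
        by (simp add: P_def algebra_simps)
      ultimately show "norm (poly (P ((a, b) # xs)) z - poly (pCons c p) z) < \<epsilon>"
        unfolding eq
        using ab norm_triangle_ineq[of "Complex (of_rat a) (of_rat b) - c" "z * (poly (P xs) z - poly p z)"]
        by linarith
    qed
  qed
  show ?thesis
  proof (rule that[of "\<lambda>n. P (from_nat n)"])
    fix K :: "complex set" and p and \<epsilon> :: real assume "compact K" "\<epsilon> > 0"
    then obtain R where R: "R > 0" "\<And>z. z \<in> K \<Longrightarrow> norm z \<le> R"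
      using compact_imp_bounded bounded_pos by metis
    obtain xs where "\<forall>z. norm z \<le> R \<longrightarrow> norm (poly (P xs) z - poly p z) < \<epsilon>"
      using main[OF R(1) \<open>\<epsilon> > 0\<close>] by blast
    then show "\<exists>n. \<forall>z\<in>K. norm (poly (P (from_nat n)) z - poly p z) < \<epsilon>"
      using R(2) by (intro exI[of _ "to_nat xs"]) auto
  qed
qed

text \<open>The numbers of multiplicity \<open>j\<close> are the odd multiples of
  \<open>2 ^ j\<close>, which are \<open>2 ^ Suc j\<close> apart. This assigns to every target a set
  of indices with bounded gaps.\<close>

lemma multiplicity_2_syndetic:
  fixes n j :: nat
  obtains i where "n \<le> i" "i < n + 2 ^ Suc j" "multiplicity 2 i = j"
proof -
  \<comment> \<open>This is \<open>(n - 2 ^ j) / 2 ^ Suc j\<close> rounded up, so that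
    \<open>i\<close> is the first odd multiple of \<open>2 ^ j\<close> from \<open>n\<close>
    on.\<close>
  define t where "t = (n + 2 ^ j - 1) div 2 ^ Suc j"
  define i where "i = 2 ^ j * (2 * t + 1)"
  have i: "i = 2 ^ Suc j * t + 2 ^ j" by (simp add: i_def)
  have "(n + 2 ^ j - 1) = 2 ^ Suc j * t + (n + 2 ^ j - 1) mod 2 ^ Suc j"
    unfolding t_def by simp
  moreover have "(n + 2 ^ j - 1) mod 2 ^ Suc j < 2 ^ Suc j" by simp
  moreover have "(2::nat) ^ j \<ge> 1" "(2::nat) ^ Suc j = 2 ^ j + 2 ^ j" by simp_all
  ultimately have "n \<le> i" "i < n + 2 ^ Suc j" unfolding i by linarith+
  moreover have "multiplicity 2 i = j"
    by (rule multiplicity_decomposeI[of _ _ _ "2 * t + 1"]) (auto simp: i_def)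
  ultimately show ?thesis using that by blast
qed

lemma taylor_coeff_eval_fps:
  assumes "fps_conv_radius F > 0"
  shows "taylor_coeff (eval_fps F) k = fps_nth F k"
  unfolding taylor_coeff_def by (rule fps_nth_fps_expansion[OF eval_fps_has_fps_expansion[OF assms], symmetric])

lemma norm_coeff_le:
  fixes p :: "complex poly"
  assumes "\<And>z. norm z \<le> 1 \<Longrightarrow> norm (poly p z) \<le> B"
  shows "norm (coeff p k) \<le> B"
proof -
  have e: "eval_fps (fps_of_poly p) = poly p" by (rule ext) simp
  have "norm ((deriv ^^ k) (poly p) 0) \<le> fact k * B / 1 ^ k"
    using assms by (intro Cauchy_inequality) (auto intro!: holomorphic_intros continuous_intros)
  moreover have "coeff p k = (deriv ^^ k) (poly p) 0 / fact k"
    using taylor_coeff_eval_fps[of "fps_of_poly p" k] by (simp add: e taylor_coeff_def)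
  ultimately have "norm (coeff p k) \<le> fact k * B / fact k"
    by (simp only: norm_divide norm_fact power_one div_by_1) (simp only: divide_right_mono fact_ge_zero)
  then show ?thesis by simp
qed

lemma poly_as_sum_upto:
  fixes p :: "complex poly"
  assumes "degree p \<le> n"
  shows "poly p z = (\<Sum>k\<le>n. coeff p k * z ^ k)"
  unfolding poly_altdef using assms
  by (intro sum.mono_neutral_left) (auto simp: coeff_eq_0)

section \<open>Construction of the series from blocks\<close>

text \<open>The linear growth allowed to the targets is absorbed by the exponential smallness of the
  tails, and every fixed polynomial satisfies both growth bounds from some index on.\<close>

locale block_construction =
  fixes K :: "complex set" and w :: "complex poly" and q :: "nat \<Rightarrow> complex poly"
  assumes w0: "poly w 0 = 0"
    and w_disc: "\<And>z. z \<in> cball 0 1 \<Longrightarrow> norm (poly w z) \<le> 1 / 64"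
    and w_K: "\<And>z. z \<in> K \<Longrightarrow> norm (poly w z - 1) \<le> 1 / 64"
    and degree_q: "\<And>i. degree (q i) \<le> i"
    and norm_q: "\<And>i z. z \<in> K \<union> cball 0 1 \<Longrightarrow> norm (poly (q i) z) \<le> real i"
begin

text \<open>A block multiplies the degree scale \<open>base ^ i\<close> by at most
  \<open>2 * degree w + 1\<close>. As \<open>base\<close> exceeds twice this factor, the next stage
  ends before half of \<open>base ^ Suc i\<close>; \<open>base\<close> is even, so this half is an
  integer.\<close>

definition base :: nat where "base = 4 * degree w + 4"

text \<open>On \<open>K\<close> the tail is close to 1 and the new stage close to
  \<open>q i\<close>; on the disc the tail is tiny and the change small. Divisibility by the power
  \<open>base ^ i\<close> of the variable leaves all lower coefficients untouched.\<close>

primrec stage :: "nat \<Rightarrow> complex poly" where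
  "stage 0 = 0"
| "stage (Suc i) = stage i + (q i - stage i) * binomial_tail w (base ^ i)"

text \<open>Since \<open>k < base ^ k\<close>, the coefficient of index \<open>k\<close> no longer
  changes from stage \<open>k\<close> on.\<close>

definition series_coeff :: "nat \<Rightarrow> complex" where
  "series_coeff k = coeff (stage k) k"

definition series :: "complex \<Rightarrow> complex" where
  "series = eval_fps (Abs_fps series_coeff)"

lemma base_ge_2: "base \<ge> 2"
  by (simp add: base_def)

lemma less_base_power: "i < base ^ i"
  using base_ge_2 by (metis less_exp order_less_le_trans power_mono le0)

text \<open>The first bound tends to 0 and controls the approximation on \<open>K\<close>; the
  second keeps the growth of the stages linear.\<close>

lemma small_factor: "2 * real i * (1 / 8) ^ base ^ i \<le> 2 * real i * (1 / 8) ^ i" "2 * real i * (1 / 8 :: real) ^ base ^ i \<le> 1"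
proof -
  show 1: "2 * real i * (1 / 8) ^ base ^ i \<le> 2 * real i * (1 / 8) ^ i"
    using less_base_power[of i] by (intro mult_left_mono power_decreasing) auto
  have "2 * i \<le> 8 ^ i"
  proof (induction i)
    case (Suc i)
    define x :: nat where "x = 8 ^ i"
    have "2 * i \<le> x" "1 \<le> x" using Suc by (simp_all add: x_def)
    then have "2 * Suc i \<le> 8 * x" by simp
    then show ?case by (simp add: x_def)
  qed simp
  then have "2 * real i \<le> 8 ^ i" by (metis of_nat_le_iff of_nat_mult of_nat_numeral of_nat_power)
  then have "2 * real i * (1 / 8) ^ i \<le> 1" by (simp add: power_divide)
  with 1 show "2 * real i * (1 / 8 :: real) ^ base ^ i \<le> 1" by linarith
qed

text \<open>Each block adds at most 1. Through Cauchy's inequality the coefficients then grow at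
  most linearly, so the series converges in the disc.\<close>

lemma norm_stage_disc:
  assumes "z \<in> cball 0 1"
  shows "norm (poly (stage i) z) \<le> real i"
proof (induction i)
  case (Suc i)
  let ?T = "poly (binomial_tail w (base ^ i)) z"
  have "norm (poly (q i) z - poly (stage i) z) \<le> 2 * real i"
    using Suc norm_q[of z i] assms norm_triangle_ineq4[of "poly (q i) z" "poly (stage i) z"] by auto
  then have "norm ((poly (q i) z - poly (stage i) z) * ?T) \<le> 2 * real i * (1 / 8) ^ base ^ i"
    unfolding norm_mult using binomial_tail_near_0[OF w_disc[OF assms]] by (intro mult_mono) auto
  also have "\<dots> \<le> 1" by (rule small_factor)
  finally show ?case
    using Suc norm_triangle_ineq[of "poly (stage i) z" "(poly (q i) z - poly (stage i) z) * ?T"] by simp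
qed simp

text \<open>The new error is the old one times 1 minus the tail. The two bounds depend on each
  other: the size of a stage bounds its distance from the target, and closeness to the target bounds
  the next stage.\<close>

lemma norm_stage_K:
  assumes "z \<in> K"
  shows "norm (poly (stage i) z) \<le> real i" "norm (poly (stage (Suc i)) z - poly (q i) z) \<le> 2 * real i * (1 / 8) ^ i"
proof -
  have step: "norm (poly (stage (Suc i)) z - poly (q i) z) \<le> 2 * real i * (1 / 8) ^ base ^ i"
    if "norm (poly (stage i) z) \<le> real i" for i
  proof -
    let ?T = "poly (binomial_tail w (base ^ i)) z"
    have eq: "poly (stage (Suc i)) z - poly (q i) z = (poly (stage i) z - poly (q i) z) * (1 - ?T)"
      by (simp add: algebra_simps)
    have "norm (poly (stage i) z - poly (q i) z) \<le> 2 * real i"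
      using that norm_q[of z i] assms norm_triangle_ineq4[of "poly (stage i) z" "poly (q i) z"] by auto
    then show ?thesis
      unfolding eq norm_mult using binomial_tail_near_1[OF w_K[OF assms]] by (intro mult_mono) auto
  qed
  have bound: "norm (poly (stage i) z) \<le> real i" for i
  proof (induction i)
    case (Suc i)
    have "norm (poly (stage (Suc i)) z - poly (q i) z) \<le> 1"
      using step[OF Suc] small_factor(2)[of i] by linarith
    then show ?case
      using norm_q[of z i] assms norm_triangle_ineq2[of "poly (stage (Suc i)) z" "poly (q i) z"] by simp
  qed simp
  show "norm (poly (stage i) z) \<le> real i" by (rule bound)
  show "norm (poly (stage (Suc i)) z - poly (q i) z) \<le> 2 * real i * (1 / 8) ^ i"
    using step[OF bound, of i] small_factor(1)[of i] by linarith
qed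

lemma degree_stage: "2 * degree (stage i) < base ^ i"
proof (induction i)
  case (Suc i)
  have "degree (q i - stage i) \<le> base ^ i"
    using degree_q[of i] less_base_power[of i] Suc by (intro degree_diff_le) auto
  then have "degree ((q i - stage i) * binomial_tail w (base ^ i)) \<le> base ^ i + 2 * base ^ i * degree w"
    using degree_mult_le[of "q i - stage i"] degree_binomial_tail[of w "base ^ i"] by (meson add_mono order_trans)
  then have "degree (stage (Suc i)) \<le> base ^ i + 2 * base ^ i * degree w"
    using Suc by (auto intro!: degree_add_le)
  then have "2 * degree (stage (Suc i)) \<le> base ^ i * (4 * degree w + 2)" by (simp add: algebra_simps)
  also have "\<dots> < base ^ i * base"
    using base_ge_2 by (intro mult_strict_left_mono zero_less_power) (simp_all add: base_def)
  finally show ?case by (simp add: mult.commute)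
qed simp

lemma coeff_stage_Suc:
  assumes "k < base ^ i"
  shows "coeff (stage (Suc i)) k = coeff (stage i) k"
proof -
  have "monom 1 (base ^ i) dvd (q i - stage i) * binomial_tail w (base ^ i)"
    using binomial_tail_dvd[OF w0] by (rule dvd_mult)
  then show ?thesis using assms by (auto simp: monom_1_dvd_iff')
qed

lemma coeff_stage_stable:
  assumes "k < base ^ i" "i \<le> j"
  shows "coeff (stage j) k = coeff (stage i) k"
  using assms(2)
proof (induction j rule: dec_induct)
  case (step j)
  have "base ^ i \<le> base ^ j" using step base_ge_2 by (intro power_increasing) auto
  then show ?case using step assms(1) coeff_stage_Suc[of k j] by simp
qed simp

lemma series_coeff_eq:
  assumes "k < base ^ i"
  shows "series_coeff k = coeff (stage i) k"
  unfolding series_coeff_def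
  using coeff_stage_stable[OF assms, of "max i k"] coeff_stage_stable[OF less_base_power[of k], of "max i k"] by simp

lemma fps_conv_radius_series: "fps_conv_radius (Abs_fps series_coeff) \<ge> 1"
  unfolding fps_conv_radius_def
proof (rule conv_radius_geI_ex')
  fix r :: real assume r: "0 < r" "ereal r < 1"
  then have summ: "summable (\<lambda>n. of_nat (Suc n) * r ^ n)"
    using geometric_deriv_sums[of r] by (simp add: sums_iff)
  have le: "norm (fps_nth (Abs_fps series_coeff) n * of_real r ^ n) \<le> of_nat (Suc n) * r ^ n" for n
  proof -
    have "norm (series_coeff n) \<le> real n"
      unfolding series_coeff_def by (rule norm_coeff_le) (auto intro: norm_stage_disc)
    then show ?thesis using r by (simp add: norm_mult norm_power mult_right_mono)
  qed
  show "summable (\<lambda>n. fps_nth (Abs_fps series_coeff) n * of_real r ^ n)"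
    by (rule summable_comparison_test'[OF summ le])
qed

lemma series_holomorphic: "series holomorphic_on ball 0 1"
proof -
  have "(ball 0 1 :: complex set) \<subseteq> eball 0 (fps_conv_radius (Abs_fps series_coeff))"
  proof
    fix z :: complex assume "z \<in> ball 0 1"
    then have "ereal (dist 0 z) < 1" by simp
    then show "z \<in> eball 0 (fps_conv_radius (Abs_fps series_coeff))"
      unfolding in_eball_iff using fps_conv_radius_series by (rule less_le_trans)
  qed
  then show ?thesis unfolding series_def by (rule holomorphic_on_eval_fps)
qed

lemma taylor_coeff_series: "taylor_coeff series k = series_coeff k"
proof -
  have "fps_conv_radius (Abs_fps series_coeff) > 0"
    by (rule less_le_trans[OF _ fps_conv_radius_series]) simp
  then show ?thesis unfolding series_def using taylor_coeff_eval_fps by simp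
qed

text \<open>There is no coefficient between half of \<open>base ^ i\<close> and \<open>base ^ i\<close>, so that the partial
  sums stay equal to \<open>stage i\<close> on a long interval of indices.\<close>

lemma taylor_sum_series:
  assumes "base ^ i \<le> 2 * n" "n < base ^ i"
  shows "taylor_sum K series n = restrict (poly (stage i)) K"
proof -
  have "degree (stage i) \<le> n" using degree_stage[of i] assms by linarith
  moreover have "coeff (stage i) k = taylor_coeff series k" if "k \<le> n" for k
    using that assms(2) series_coeff_eq[of k i] by (simp add: taylor_coeff_series)
  ultimately have "poly (stage i) z = (\<Sum>k\<le>n. taylor_coeff series k * z ^ k)" for z
    by (simp add: poly_as_sum_upto)
  then show ?thesis unfolding taylor_sum_def by (intro restrict_ext) simp
qed

end

section \<open>Lower density and the final assembly\<close>

lemma lower_density_pos: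
  assumes "C > 0" and ev: "\<And>n. n \<ge> N \<Longrightarrow> n \<le> C * card (E \<inter> {0..n})"
  shows "lower_density E > 0"
proof -
  have "eventually (\<lambda>n. ereal (1 / real C) \<le> ereal (real (card (E \<inter> {0..n})) / real n)) sequentially"
    using eventually_ge_at_top[of "max N 1"]
  proof eventually_elim
    case (elim n)
    then have "real n \<le> real (C * card (E \<inter> {0..n}))" using ev[of n] by (intro of_nat_mono) auto
    then show ?case using elim \<open>C > 0\<close> by (simp add: divide_simps mult.commute)
  qed
  then have "ereal (1 / real C) \<le> lower_density E"
    unfolding lower_density_def by (rule Liminf_bounded)
  moreover have "0 < ereal (1 / real C)" using \<open>C > 0\<close> by simp
  ultimately show ?thesis by (rule less_le_trans[rotated])
qed

text \<open>Below \<open>n\<close> there is a good block \<open>{h..<2 * h}\<close> ending at most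
  \<open>P\<close> powers of \<open>b\<close> before the power following \<open>n\<close>, so its
  length \<open>h\<close> is at least \<open>n / (2 * b ^ P)\<close>.\<close>

lemma lower_density_geometric_blocks:
  fixes b P :: nat
  assumes "b \<ge> 2" "even b" and syn: "\<And>n. n \<ge> m \<Longrightarrow> \<exists>i. n \<le> i \<and> i < n + P \<and> I i"
    and E: "\<And>i n. I i \<Longrightarrow> i \<ge> m \<Longrightarrow> b ^ Suc i \<le> 2 * n \<Longrightarrow> n < b ^ Suc i \<Longrightarrow> n \<in> E"
  shows "lower_density E > 0"
proof (rule lower_density_pos)
  show "2 * b ^ P > 0" using \<open>b \<ge> 2\<close> by simp
  fix n assume n: "n \<ge> b ^ (m + P)"
  then have "n \<ge> 1" using \<open>b \<ge> 2\<close> by (meson le_trans one_le_power one_le_numeral order_trans)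
  then obtain l where l: "b ^ l \<le> n" "n < b ^ (l + 1)"
    using ex_power_ivl1[OF \<open>b \<ge> 2\<close>] by blast
  have "b ^ (m + P) < b ^ (l + 1)" using n l by linarith
  then have "m + P < l + 1" by (rule power_less_imp_less_exp[rotated]) (use \<open>b \<ge> 2\<close> in simp)
  then have lP: "m \<le> l - P" "P \<le> l" by auto
  \<comment> \<open>Searching from \<open>l - P\<close> gives \<open>i < l\<close>, so the block
    ends at \<open>b ^ Suc i \<le> b ^ l \<le> n\<close>.\<close>
  then obtain i where i: "l - P \<le> i" "i < l - P + P" "I i" using syn by blast
  define h where "h = b ^ Suc i div 2"
  have h: "b ^ Suc i = 2 * h" using \<open>even b\<close> by (simp add: h_def)
  have "2 * h \<le> n"
  proof -
    have "b ^ Suc i \<le> b ^ l" using i lP \<open>b \<ge> 2\<close> by (intro power_increasing) auto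
    then show ?thesis using l h by simp
  qed
  then have "{h..<2 * h} \<subseteq> E \<inter> {0..n}"
    using E[OF i(3)] h i(1) lP by auto
  then have "h \<le> card (E \<inter> {0..n})"
    using card_mono[of "E \<inter> {0..n}" "{h..<2 * h}"] by simp
  have "n \<le> b ^ (l + 1)" using l by simp
  also have "\<dots> \<le> b ^ (Suc i + P)" using i lP \<open>b \<ge> 2\<close> by (intro power_increasing) auto
  also have "\<dots> = 2 * b ^ P * h" unfolding power_add h by simp
  also have "\<dots> \<le> 2 * b ^ P * card (E \<inter> {0..n})"
    using \<open>h \<le> card (E \<inter> {0..n})\<close> by (rule mult_le_mono2)
  finally show "n \<le> 2 * b ^ P * card (E \<inter> {0..n})" .
qed

lemma open_A_space_contains:
  assumes K: "compact K" and U: "openin (mtopology_of (A_space K)) U" "U \<noteq> {}"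
  obtains g \<epsilon> where "\<epsilon> > 0" "continuous_on K g" "g holomorphic_on interior K"
    "\<forall>h\<in>mspace (A_space K). (\<forall>z\<in>K. norm (h z - g z) \<le> \<epsilon>) \<longrightarrow> h \<in> U"
proof -
  interpret Metric_space "mspace (A_space K)" "mdist (A_space K)" by (rule Metric_space_mspace_mdist)
  obtain g where "g \<in> U" using U(2) by blast
  have sub: "U \<subseteq> mspace (A_space K)" using openin_subset[OF U(1)] by simp
  have gm: "g \<in> mspace (A_space K)" using sub \<open>g \<in> U\<close> by blast
  obtain r where r: "r > 0" "mball g r \<subseteq> U"
    using U(1) \<open>g \<in> U\<close> by (auto simp: mtopology_of_def openin_mtopology)
  have "h \<in> U" if h: "h \<in> mspace (A_space K)" "\<forall>z\<in>K. norm (h z - g z) \<le> r / 2" for h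
    proof (cases "K = {}")
      case True
      moreover have "g \<in> extensional K" "h \<in> extensional K"
        using gm h(1) by (simp_all add: mspace_A_space[OF K])
      ultimately have "h = g" by (auto intro: extensionalityI[of _ K])
      then show ?thesis using \<open>g \<in> U\<close> by simp
    next
      case False
      have "mdist (A_space K) g h = (SUP z\<in>K. dist (g z) (h z))"
        by (rule mdist_A_space[OF K False gm h(1)])
      also have "\<dots> \<le> r / 2"
        using False h(2) by (intro cSUP_least) (auto simp: dist_norm norm_minus_commute)
      finally have "h \<in> mball g r" using r gm h(1) by simp
      then show ?thesis using r by blast
    qed
  moreover have "continuous_on K g" "g holomorphic_on interior K"
    using gm by (auto simp: mspace_A_space[OF K])
  ultimately show ?thesis using that[of "r / 2" g] r(1) by simp
qed

theorem theoremB: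
  fixes K :: "complex set"
  assumes "compact K"
    and "K \<subseteq> - cball 0 1"
    and "connected (- K)"
  shows "FU K \<noteq> {}"
proof -
  obtain w where w: "poly w 0 = 0" "\<And>z. z \<in> cball 0 1 \<Longrightarrow> norm (poly w z) \<le> 1 / 64"
    "\<And>z. z \<in> K \<Longrightarrow> norm (poly w z - 1) \<le> 1 / 64"
    using separating_polynomial[OF assms, of "1 / 64"] by auto
  obtain e :: "nat \<Rightarrow> complex poly"
    where e: "\<And>K p \<epsilon>. compact K \<Longrightarrow> \<epsilon> > 0 \<Longrightarrow> \<exists>n. \<forall>z\<in>K. norm (poly (e n) z - poly p z) < \<epsilon>"
    using exists_dense_polynomials by blast
  define tame where "tame p i \<longleftrightarrow> degree p \<le> i \<and> (\<forall>z\<in>K \<union> cball 0 1. norm (poly p z) \<le> real i)" for p i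
  \<comment> \<open>Target \<open>j\<close> is assigned to the indices of multiplicity
    \<open>j\<close>; the default 0 always obeys the growth bounds and replaces a target that is
    still too large for its index.\<close>
  define q where "q i = (if tame (e (multiplicity 2 i)) i then e (multiplicity 2 i) else 0)" for i :: nat
  interpret block_construction K w q
    by unfold_locales (use w in \<open>auto simp: q_def tame_def\<close>)
  have tame: "\<exists>n. \<forall>i\<ge>n. tame p i" for p
  proof -
    have "compact (poly p ` (K \<union> cball 0 1))"
      using assms(1) by (intro compact_continuous_image continuous_intros) auto
    then obtain B where B: "\<And>z. z \<in> K \<union> cball 0 1 \<Longrightarrow> norm (poly p z) \<le> B"
      using compact_imp_bounded bounded_pos by (metis imageI)
    have "tame p i" if "i \<ge> max (degree p) (nat \<lceil>B\<rceil>)" for i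
      unfolding tame_def using that B by (fastforce intro: order_trans)
    then show ?thesis by blast
  qed
  have "lower_density {n. taylor_sum K series n \<in> U} > 0"
    if U: "openin (mtopology_of (A_space K)) U" "U \<noteq> {}" for U
  proof -
    obtain g \<epsilon> where g: "\<epsilon> > 0" "continuous_on K g" "g holomorphic_on interior K"
      "\<forall>h\<in>mspace (A_space K). (\<forall>z\<in>K. norm (h z - g z) \<le> \<epsilon>) \<longrightarrow> h \<in> U"
      by (rule open_A_space_contains[OF assms(1) U], rule that, assumption+)
    \<comment> \<open>The three thirds: from \<open>g\<close> to a polynomial by Mergelyan's
      theorem, from there to a member of the sequence, and from that to the stage.\<close>
    have "\<epsilon> / 3 > 0" using g(1) by simp
    then obtain p where p: "\<And>z. z \<in> K \<Longrightarrow> norm (g z - poly p z) < \<epsilon> / 3"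
      using mergelyan[OF assms(1,3) g(2,3)] unfolding poly_approximable_def by blast
    obtain j where j: "\<And>z. z \<in> K \<Longrightarrow> norm (poly (e j) z - poly p z) < \<epsilon> / 3"
      using e[OF assms(1) \<open>\<epsilon> / 3 > 0\<close>] by blast
    obtain n1 where n1: "\<And>i. i \<ge> n1 \<Longrightarrow> tame (e j) i" using tame by blast
    have "(\<lambda>i. 2 * real i * (1 / 8) ^ i) \<longlonglongrightarrow> 0"
      using tendsto_mult_left[OF powser_times_n_limit_0[of "1 / 8 :: real"], of 2] by (simp add: mult.assoc)
    then have "eventually (\<lambda>i. 2 * real i * (1 / 8) ^ i < \<epsilon> / 3) sequentially"
      using \<open>\<epsilon> / 3 > 0\<close> by (rule order_tendstoD)
    then obtain n2 where n2: "\<And>i. i \<ge> n2 \<Longrightarrow> 2 * real i * (1 / 8) ^ i < \<epsilon> / 3"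
      by (auto simp: eventually_sequentially)
    show ?thesis
    proof (rule lower_density_geometric_blocks[where b = base and P = "2 ^ Suc j" and m = "max n1 n2"
          and I = "\<lambda>i. multiplicity 2 i = j"])
      show "base \<ge> 2" "even base" by (auto simp: base_def)
      show "\<exists>i. n \<le> i \<and> i < n + 2 ^ Suc j \<and> multiplicity 2 i = j" for n :: nat
        using multiplicity_2_syndetic by metis
      fix i n assume i: "multiplicity 2 i = j" "max n1 n2 \<le> i" and n: "base ^ Suc i \<le> 2 * n" "n < base ^ Suc i"
      have q: "q i = e j" using i n1 by (simp add: q_def)
      have "norm (taylor_sum K series n z - g z) \<le> \<epsilon>" if "z \<in> K" for z
      proof -
        have "norm (poly (stage (Suc i)) z - poly (e j) z) < \<epsilon> / 3"
          using norm_stage_K(2)[OF that, of i] n2[of i] i(2) unfolding q by linarith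
        moreover have "taylor_sum K series n z = poly (stage (Suc i)) z"
          using taylor_sum_series[OF n] that by simp
        moreover have "norm (a - d) \<le> norm (a - b) + norm (b - c) + norm (d - c)" for a b c d :: complex
          using norm_triangle_ineq[of "a - b" "b - d"] norm_triangle_ineq4[of "b - c" "d - c"] by simp
        from this[of "poly (stage (Suc i)) z" "g z" "poly (e j) z" "poly p z"]
        have "norm (poly (stage (Suc i)) z - g z) \<le> norm (poly (stage (Suc i)) z - poly (e j) z) +
            norm (poly (e j) z - poly p z) + norm (g z - poly p z)" .
        ultimately show ?thesis using p[OF that] j[OF that] by simp
      qed
      then show "n \<in> {n. taylor_sum K series n \<in> U}"
        using g(4) taylor_sum_in_A_space[OF assms(1)] by blast
    qed
  qed
  then have "series \<in> FU K"
    unfolding FU_def using series_holomorphic by blast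
  then show ?thesis by blast
qed

end
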